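(* Let $p>5$ be a prime. Then $$\sum_{k=1}^{p-1}\frac{H_{k-1}^{(2)}}{k^2\binom{2k}{k}}\equiv\frac{H_{p-1}}{3p^3}+\frac{26}{135}\,p\,B_{p-5}\pmod{p^2}.$$
   Context: For integers $n\ge 0$ and $m\ge1$, $H_n^{(m)}=\sum_{k=1}^n \frac1{k^m}$ (the empty sum being $0$), and $H_n=H_n^{(1)}$. The Bernoulli numbers $B_n$ are defined by $\frac{x}{e^x-1}=\sum_{n=0}^{\infty}B_n\frac{x^n}{n!}$. For rational numbers $a,b$ and an integer $r\ge1$, $a\equiv b\pmod{p^r}$ means that the $p$-adic valuation of $a-b$ is at least $r$ (i.e. $(a-b)/p^r$ has denominator prime to $p$); the individual terms $a,b$ need not be $p$-integral. *)

theory Defs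
  imports Complex_Main "HOL-Computational_Algebra.Computational_Algebra"
begin

definition gen_harm :: "nat \<Rightarrow> nat \<Rightarrow> rat" where
  "gen_harm m n = (\<Sum>k=1..n. 1 / of_nat k ^ m)"

definition bernoulli :: "nat \<Rightarrow> rat" where
  "bernoulli n = fact n * fps_nth (fps_X / (fps_exp 1 - 1)) n"

text \<open>
  The division in the definition of \<open>bernoulli\<close> is that of formal power series over a field:
  it is exact, although \<open>fps_exp 1 - 1\<close> is not a unit.
\<close>

lemma bernoulli_egf:
  "Abs_fps (\<lambda>n. bernoulli n / fact n) * (fps_exp 1 - 1) = fps_X"
proof -
  have nz1: "fps_nth (fps_exp (1::rat) - 1) 1 \<noteq> 0"
    by simp
  have nz: "fps_exp (1::rat) - 1 \<noteq> 0"
    using nz1 by (metis fps_zero_nth)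
  have "subdegree (fps_exp (1::rat) - 1) \<le> 1"
    using nz1 by (rule subdegree_leI)
  then have "fps_exp (1::rat) - 1 dvd fps_X"
    using nz by (simp add: fps_dvd_iff)
  then have "fps_X / (fps_exp (1::rat) - 1) * (fps_exp 1 - 1) = fps_X"
    by simp
  moreover have "Abs_fps (\<lambda>n. bernoulli n / fact n) = fps_X / (fps_exp 1 - 1)"
    by (simp add: fps_eq_iff bernoulli_def)
  ultimately show ?thesis
    by simp
qed

text \<open>The value at \<open>x = 0\<close> is irrelevant: \<open>rat_cong\<close> treats it separately, as valuation infinity.\<close>

definition padic_val :: "nat \<Rightarrow> rat \<Rightarrow> int" where
  "padic_val p x = int (multiplicity (int p) (fst (quotient_of x)))
                 - int (multiplicity (int p) (snd (quotient_of x)))"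

definition rat_cong :: "nat \<Rightarrow> nat \<Rightarrow> rat \<Rightarrow> rat \<Rightarrow> bool" where
  "rat_cong p r a b \<longleftrightarrow> a = b \<or> padic_val p (a - b) \<ge> int r"

end

theory Submission
  imports Defs "HOL-Number_Theory.Number_Theory"
begin

text \<open>
  Write \<open>H\<^sub>s\<close> for \<open>H\<^sub>p\<^sub>-\<^sub>1\<^sup>(\<^sup>s\<^sup>)\<close>, and \<open>S\<^sub>0\<close>, \<open>S\<^sub>2\<close>, \<open>S\<^sub>4\<close> for the sums of
  \<open>e\<^sub>m(1, 1/4, \<dots>, 1/(k-1)\<^sup>2) / (k\<^sup>2 (2k choose k))\<close>, \<open>1 \<le> k < p\<close>, with \<open>m = 0, 1, 2\<close>; the sum in
  question is \<open>S\<^sub>2\<close>.  The Chebyshev type identity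
  \<open>\<Sum>\<^sub>k (\<Prod>\<^sub>i\<^sub><\<^sub>k (1 - p\<^sup>2/i\<^sup>2)) / (k\<^sup>2 (2k choose k)) = 0\<close> gives
  \<open>p\<^sup>2 S\<^sub>2 = S\<^sub>0 + p\<^sup>4 S\<^sub>4\<close> up to \<open>p\<^sup>5\<close>, so \<open>S\<^sub>0\<close> is needed modulo \<open>p\<^sup>4\<close> and \<open>p S\<^sub>4\<close> modulo \<open>p\<close>.

  Apery's finite identity for \<open>\<zeta>(2)\<close> expresses \<open>3 S\<^sub>0\<close> through \<open>2 \<Sum> (-1)\<^sup>k\<^sup>-\<^sup>1/k\<^sup>2\<close> and
  \<open>\<Sum> 1/((p-k) \<Prod>\<^sub>i\<^sub><\<^sub>k (1 - p\<^sup>2/i\<^sup>2))\<close>.  The first sum reduces to \<open>H\<^sub>2\<close> and \<open>H\<^sub>4\<close> by comparing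
  the even numbers below \<open>p\<close> and below \<open>2p\<close>.  The second one is compared term by term with the
  exact evaluation \<open>\<Sum> (1/k) \<Prod>\<^sub>i\<^sub>\<le>\<^sub>k (1 - p\<^sup>2/i\<^sup>2) = -2 H\<^sub>1\<close>, which eliminates the double sum
  \<open>\<Sum>\<^sub>i\<^sub><\<^sub>k 1/(i\<^sup>2 k)\<close>; only \<open>\<Sum>\<^sub>i\<^sub><\<^sub>k 1/(i\<^sup>2 k\<^sup>3)\<close> modulo \<open>p\<close> survives.

  For \<open>S\<^sub>4\<close>, partial fractions turn \<open>p S\<^sub>4\<close> into \<open>2 \<Sum> cos(\<pi>n/3)/n\<^sup>5\<close> modulo \<open>p\<close>, and this is
  a multiple of \<open>H\<^sub>4/p\<close> by evaluating \<open>\<Sum> cos(\<pi>m/3)/m\<^sup>4\<close> over \<open>m < 6p\<close>, \<open>p\<close> not dividing \<open>m\<close>,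
  in two ways.  Faulhaber's formula finally brings in \<open>B\<^sub>p\<^sub>-\<^sub>5\<close>.
\<close>

section \<open>Identities for central binomial sums\<close>

definition cube_char :: "nat \<Rightarrow> rat" where
  "cube_char n = (if 3 dvd n then 1 else - 1 / 2)"

lemma cube_char_recurrence: "cube_char n + cube_char (n + 1) + cube_char (n + 2) = 0"
proof -
  have "3 dvd n \<and> \<not> 3 dvd n + 1 \<and> \<not> 3 dvd n + 2 \<or>
      \<not> 3 dvd n \<and> 3 dvd n + 1 \<and> \<not> 3 dvd n + 2 \<or>
      \<not> 3 dvd n \<and> \<not> 3 dvd n + 1 \<and> 3 dvd n + 2"
    by presburger
  then show ?thesis
    unfolding cube_char_def by (elim disjE conjE) simp_all
qed

lemma cube_char_shift: "cube_char (3 * m + n) = cube_char n"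
  unfolding cube_char_def by (metis dvd_add_right_iff dvd_triv_left)

lemma cube_char_reflect: "n \<le> 3 * m \<Longrightarrow> cube_char (3 * m - n) = cube_char n"
  unfolding cube_char_def by (metis dvd_diff_nat dvd_triv_left diff_diff_cancel)

lemma sum_choose_Suc:
  fixes f :: "nat \<Rightarrow> 'a::comm_ring_1"
  shows "(\<Sum>i\<le>Suc N. of_nat (Suc N choose i) * f i)
       = (\<Sum>i\<le>N. of_nat (N choose i) * (f i + f (Suc i)))"
proof -
  have "(\<Sum>i\<le>Suc N. of_nat (Suc N choose i) * f i)
      = f 0 + (\<Sum>i\<le>N. of_nat (N choose i) * f (Suc i) + of_nat (N choose Suc i) * f (Suc i))"
    by (simp add: sum.atMost_Suc_shift algebra_simps del: sum.atMost_Suc)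
  also have "\<dots> = (\<Sum>i\<le>N. of_nat (N choose i) * f (Suc i)) + (\<Sum>i\<le>Suc N. of_nat (N choose i) * f i)"
    by (simp add: sum.atMost_Suc_shift sum.distrib binomial_eq_0 del: sum.atMost_Suc)
  finally show ?thesis by (simp add: sum.distrib algebra_simps binomial_eq_0)
qed

text \<open>This is \<open>\<zeta>\<^sup>2\<^sup>M (1 + \<zeta>)\<^sup>2\<^sup>M = 1\<close> for a primitive cube root of unity \<open>\<zeta>\<close>,
  with \<open>cube_char n\<close> the real part of \<open>\<zeta>\<^sup>n\<close>.\<close>
lemma sum_choose_cube_char:
  "(\<Sum>i\<le>2 * M. of_nat (2 * M choose i) * cube_char (i + 2 * M)) = 1"
proof (induction M)
  case 0
  show ?case by (simp add: cube_char_def)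
next
  case (Suc M)
  have step: "cube_char (i + 2 * Suc M) + cube_char (Suc i + 2 * Suc M)
            + (cube_char (Suc i + 2 * Suc M) + cube_char (Suc (Suc i) + 2 * Suc M))
            = cube_char (i + 2 * M)" for i
    using cube_char_recurrence[of "i + 2 * Suc M"] cube_char_shift[of 1 "i + 2 * M"]
    by (simp add: algebra_simps eval_nat_numeral)
  have "(\<Sum>i\<le>Suc (Suc (2 * M)). of_nat (Suc (Suc (2 * M)) choose i) * cube_char (i + 2 * Suc M))
      = (\<Sum>i\<le>2 * M. of_nat (2 * M choose i) * cube_char (i + 2 * M))"
    by (simp only: sum_choose_Suc step)
  then show ?case using Suc by simp
qed

text \<open>For n <= k this is k!^2 / ((k - n)! (k + n)!). Its recurrence in \<open>k\<close>
  involves \<open>n\<close> only through n^2, which is why weighted sums over \<open>k\<close>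
  telescope.\<close>

definition central_ratio :: "nat \<Rightarrow> nat \<Rightarrow> rat" where
  "central_ratio k n = of_nat ((2 * k) choose (k + n)) / of_nat ((2 * k) choose k)"

lemma central_choose_neq_0 [simp]: "of_nat ((2 * k) choose k) \<noteq> (0::'a::field_char_0)"
  by simp

lemma central_ratio_eq_0: "k < n \<Longrightarrow> central_ratio k n = 0"
  by (simp add: central_ratio_def)

text \<open>Divide \<open>sum_choose_cube_char\<close> by its middle binomial coefficient and pair
  the indices \<open>M + n\<close> and \<open>M - n\<close>, whose contributions agree. The terms
  with n > M are 0, so that one upper limit \<open>N\<close> serves all \<open>M\<close> and sums
  can be exchanged later.\<close>

lemma inverse_central_choose:
  assumes "M \<le> N"
  shows "1 / of_nat ((2 * M) choose M) = 1 + 2 * (\<Sum>n=1..N. cube_char n * central_ratio M n)"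
proof -
  let ?C = "\<lambda>i. of_nat (2 * M choose i) :: rat"
  let ?S = "\<Sum>n=1..M. ?C (M + n) * cube_char n"
  have c: "cube_char (i - M) = cube_char (i + 2 * M)" if "M < i" for i
  proof -
    have "i + 2 * M = 3 * M + (i - M)" using that by simp
    then show ?thesis by (simp only: cube_char_shift)
  qed
  let ?f = "\<lambda>i. ?C i * cube_char (i + 2 * M)"
  have split: "{..2 * M} = {..<M} \<union> insert M {M<..2*M}" by auto
  have "sum ?f {..2 * M} = sum ?f {..<M} + sum ?f (insert M {M<..2*M})"
    unfolding split by (rule sum.union_disjoint) auto
  also have "sum ?f (insert M {M<..2*M}) = ?f M + sum ?f {M<..2*M}"
    by (rule sum.insert) auto
  also have "(\<Sum>i\<in>{M<..2*M}. ?C i * cube_char (i + 2 * M)) = ?S"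
    by (rule sum.reindex_bij_witness[of _ "\<lambda>n. M + n" "\<lambda>i. i - M"])
       (auto simp: c)
  also have "(\<Sum>i\<in>{..<M}. ?C i * cube_char (i + 2 * M)) = ?S"
  proof (rule sum.reindex_bij_witness[of _ "\<lambda>n. M - n" "\<lambda>i. M - i"])
    fix i assume "i \<in> {..<M}"
    then have i: "i < M" by simp
    have "cube_char (M - i) = cube_char (3 * M - (M - i))"
      using i by (intro cube_char_reflect[symmetric]) auto
    also have "3 * M - (M - i) = i + 2 * M" using i by auto
    finally have "cube_char (M - i) = cube_char (i + 2 * M)" .
    moreover have "(2 * M) choose (M + (M - i)) = (2 * M) choose i"
      using i by (subst binomial_symmetric) auto
    ultimately show "?C (M + (M - i)) * cube_char (M - i) = ?C i * cube_char (i + 2 * M)"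
      by simp
  qed auto
  also have "cube_char (M + 2 * M) = 1" by (simp add: cube_char_def)
  finally have "1 = ?C M + 2 * ?S" using sum_choose_cube_char[of M] by simp
  moreover have "(\<Sum>n=1..N. cube_char n * central_ratio M n) = (\<Sum>n=1..M. cube_char n * central_ratio M n)"
    using assms by (intro sum.mono_neutral_right) (auto simp: central_ratio_eq_0)
  moreover have "\<dots> = ?S / ?C M"
    by (simp add: central_ratio_def sum_divide_distrib mult.commute)
  ultimately show ?thesis by (simp add: field_simps)
qed

text \<open>Factorials cancel for n <= k. For n = k + 1 the left side is 0 and the factor on the
  right vanishes as well.\<close>

lemma central_ratio_Suc:
  "central_ratio k n = (1 - of_nat n ^ 2 / of_nat (Suc k) ^ 2) * central_ratio (Suc k) n"
proof (cases "n \<le> k")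
  case True
  then obtain m where k: "k = n + m" using le_Suc_ex by blast
  have choose: "of_nat (a choose b) = (fact a / (fact b * fact c) :: rat)" if "a = b + c" for a b c
    using that by (simp add: binomial_fact)
  have 1: "of_nat ((2 * k) choose (k + n)) = (fact (2 * k) / (fact (k + n) * fact m) :: rat)"
    by (rule choose) (simp add: k)
  have 2: "of_nat ((2 * Suc k) choose (Suc k + n)) = (fact (2 * Suc k) / (fact (Suc (k + n)) * fact (Suc m)) :: rat)"
    unfolding add_Suc by (rule choose) (simp add: k)
  have 3: "of_nat ((2 * k) choose k) = (fact (2 * k) / (fact k * fact k) :: rat)"
    by (rule choose) simp
  have 4: "of_nat ((2 * Suc k) choose (Suc k)) = (fact (2 * Suc k) / (fact (Suc k) * fact (Suc k)) :: rat)"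
    by (rule choose) simp
  define C D E where "C = (fact k :: rat)" and "D = (fact (k + n) :: rat)" and "E = (fact m :: rat)"
  have L: "central_ratio k n = C * C / (D * E)"
    unfolding central_ratio_def 1 3 by (simp add: C_def D_def E_def del: fact_Suc)
  have R: "central_ratio (Suc k) n = (of_nat (Suc k) * C) * (of_nat (Suc k) * C) / ((of_nat (Suc (k + n)) * D) * (of_nat (Suc m) * E))"
    unfolding central_ratio_def 2 4 C_def D_def E_def fact_Suc[of k] fact_Suc[of "k + n"] fact_Suc[of m]
    by (simp del: of_nat_Suc fact_Suc)
  define x y where "x = (of_nat n :: rat)" and "y = (of_nat m :: rat)"
  have xy: "x \<ge> 0" "y \<ge> 0" by (simp_all add: x_def y_def)
  have pos: "x + y + 1 \<noteq> 0" "2 * x + y + 1 \<noteq> 0" "y + 1 \<noteq> 0"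
    using xy by linarith+
  have e: "of_nat (Suc k) = x + y + 1" "of_nat (Suc (k + n)) = 2 * x + y + 1" "of_nat (Suc m) = y + 1"
      "of_nat n = x"
    by (simp_all add: x_def y_def k)
  have f: "1 - x ^ 2 / (x + y + 1) ^ 2 = (2 * x + y + 1) * (y + 1) / ((x + y + 1) * (x + y + 1))"
  proof -
    have "(x + y + 1) ^ 2 - x ^ 2 = (2 * x + y + 1) * (y + 1)"
      by (simp add: power2_eq_square algebra_simps)
    moreover have "1 - x ^ 2 / (x + y + 1) ^ 2 = ((x + y + 1) ^ 2 - x ^ 2) / (x + y + 1) ^ 2"
      using pos(1) by (simp add: diff_divide_distrib)
    ultimately show ?thesis by (simp add: power2_eq_square)
  qed
  have "C * C / (D * E) = a * b / (s * s) * ((s * C) * (s * C) / ((a * D) * (b * E)))"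
    if "a \<noteq> 0" "b \<noteq> 0" "s \<noteq> 0" for a b s
    using that by (simp add: mult_ac)
  then show ?thesis unfolding L R e f using pos by blast
next
  case False
  then have "n = Suc k \<or> Suc k < n" by auto
  then show ?thesis
  proof
    assume "n = Suc k"
    then show ?thesis by (simp add: central_ratio_eq_0 del: of_nat_Suc)
  qed (auto simp: central_ratio_eq_0)
qed

section \<open>Telescoping and the Chebyshev type identity\<close>

text \<open>Summation by parts: by \<open>central_ratio_Suc\<close> the summand is
  \<open>central_ratio k n * X k - central_ratio (k - 1) n * X (k - 1)\<close>, and the boundary
  term at 0 vanishes since n > 0. The sequence \<open>X\<close> is arbitrary: products of 1 -
  a^2/i^2 in one use, symmetric functions of the 1/i^2 in another.\<close>

lemma central_ratio_telescope:
  assumes "n > 0"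
  shows "(\<Sum>k=1..N. central_ratio k n * (of_nat n ^ 2 / of_nat k ^ 2 * X (k - 1) + (X k - X (k - 1))))
       = central_ratio N n * X N"
proof (induction N)
  case 0
  show ?case using assms by (simp add: central_ratio_eq_0)
next
  case (Suc N)
  have "(\<Sum>k=1..Suc N. central_ratio k n * (of_nat n ^ 2 / of_nat k ^ 2 * X (k - 1) + (X k - X (k - 1))))
      = central_ratio N n * X N + central_ratio (Suc N) n * (of_nat n ^ 2 / of_nat (Suc N) ^ 2 * X N + (X (Suc N) - X N))"
    using Suc by simp
  also have "\<dots> = central_ratio (Suc N) n * X (Suc N)"
    unfolding central_ratio_Suc[of N n] by (simp add: algebra_simps del: of_nat_Suc)
  finally show ?case .
qed

text \<open>Each factor is -((n - i) / i) ((n + i) / i), and the two products so obtained are the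
  two binomial coefficients.\<close>

lemma prod_one_minus_square_eq_binomial:
  assumes "j < n"
  shows "(\<Prod>i=1..j. 1 - of_nat n ^ 2 / of_nat i ^ 2) = ((-1) ^ j * of_nat (n - 1 choose j) * of_nat (n + j choose j) :: rat)"
  using assms
proof (induction j)
  case 0
  show ?case by simp
next
  case (Suc j)
  have 1: "of_nat (Suc j) * of_nat (n - 1 choose Suc j) = (of_nat n - of_nat (Suc j)) * (of_nat (n - 1 choose j) :: rat)"
  proof -
    have "Suc j * (n - 1 choose Suc j) = (n - 1 choose j) * (n - 1 - j)"
      using binomial_absorb_comp[of "n - 1" j] binomial_absorption[of j "n - 1"]
      by (simp add: mult.commute)
    then have "of_nat (Suc j) * of_nat (n - 1 choose Suc j) = (of_nat (n - 1 choose j) * of_nat (n - 1 - j) :: rat)"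
      by (simp only: flip: of_nat_mult)
    moreover have "of_nat (n - 1 - j) = (of_nat n - of_nat (Suc j) :: rat)"
      using Suc.prems by (simp add: of_nat_diff)
    ultimately show ?thesis by simp
  qed
  have 2: "of_nat (Suc j) * of_nat (n + Suc j choose Suc j) = (of_nat n + of_nat (Suc j)) * (of_nat (n + j choose j) :: rat)"
  proof -
    have "Suc j * (n + Suc j choose Suc j) = (n + Suc j) * (n + j choose j)"
      using Suc_times_binomial_eq[of "n + j" j] by simp
    then show ?thesis by (simp only: flip: of_nat_mult of_nat_add)
  qed
  define J where "J = (of_nat (Suc j) :: rat)"
  have J: "J \<noteq> 0" by (simp add: J_def del: of_nat_Suc)
  have ch1: "of_nat (n - 1 choose Suc j) = (of_nat n - J) * (of_nat (n - 1 choose j) :: rat) / J"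
    using 1 J unfolding J_def[symmetric] by (simp add: field_simps)
  have ch2: "of_nat (n + Suc j choose Suc j) = (of_nat n + J) * (of_nat (n + j choose j) :: rat) / J"
    using 2 J unfolding J_def[symmetric] by (simp add: field_simps)
  have J2: "1 - of_nat n ^ 2 / J ^ 2 = - ((of_nat n - J) / J * ((of_nat n + J) / J))"
    using J by (simp add: field_simps power2_eq_square)
  have "(\<Prod>i=1..Suc j. 1 - of_nat n ^ 2 / of_nat i ^ 2)
      = ((-1) ^ j * of_nat (n - 1 choose j) * of_nat (n + j choose j) :: rat) * (1 - of_nat n ^ 2 / J ^ 2)"
    using Suc by (simp add: J_def)
  also have "\<dots> = (-1) ^ Suc j * of_nat (n - 1 choose Suc j) * of_nat (n + Suc j choose Suc j)"
    unfolding ch1 ch2 J2 by simp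
  finally show ?case .
qed

text \<open>Negating the upper index turns \<open>(-1) ^ j * (n + j choose j)\<close> into a
  generalized binomial coefficient with top -n - 1. Vandermonde's convolution with top n then leaves
  -1 choose n.\<close>

lemma sum_alternating_binomial_prod:
  "(\<Sum>j\<le>n. (-1) ^ j * of_nat (n choose j) * of_nat (n + j choose j)) = ((-1) ^ n :: rat)"
proof -
  have g: "(- of_nat n - 1) gchoose j = ((-1) ^ j * of_nat (n + j choose j) :: rat)" for j
    using gbinomial_minus[of "of_nat (n + 1) :: rat" j]
    by (simp add: binomial_gbinomial add_ac minus_diff_commute flip: diff_conv_add_uminus)
  have "(-1) ^ n = ((-1) gchoose n :: rat)"
    using gbinomial_minus[of "1::rat" n] binomial_gbinomial[of n n, where ?'a = rat] by simp
  also have "\<dots> = (\<Sum>j\<le>n. ((- of_nat n - 1) gchoose j) * ((of_nat n) gchoose (n - j)))"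
    by (subst atMost_atLeast0, subst gbinomial_Vandermonde) simp
  also have "\<dots> = (\<Sum>j\<le>n. (-1) ^ j * of_nat (n choose j) * of_nat (n + j choose j))"
    by (intro sum.cong) (auto simp: g binomial_gbinomial[symmetric] binomial_symmetric[symmetric])
  finally show ?thesis by simp
qed

text \<open>Inserting \<open>inverse_central_choose\<close> and exchanging sums removes the central
  binomial from the denominator: what remains are inner sums over \<open>k\<close> that
  \<open>central_ratio_telescope\<close> can evaluate.\<close>

lemma sum_div_central_choose:
  "(\<Sum>k=1..N. w k / of_nat ((2 * k) choose k))
     = (\<Sum>k=1..N. w k) + 2 * (\<Sum>n=1..N. cube_char n * (\<Sum>k=1..N. w k * central_ratio k n))"
proof -
  have "(\<Sum>k=1..N. w k / of_nat ((2 * k) choose k))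
      = (\<Sum>k=1..N. w k * (1 + 2 * (\<Sum>n=1..N. cube_char n * central_ratio k n)))"
  proof (rule sum.cong)
    fix k assume "k \<in> {1..N}"
    then have "1 / of_nat ((2 * k) choose k) = 1 + 2 * (\<Sum>n=1..N. cube_char n * central_ratio k n)"
      by (intro inverse_central_choose) simp
    then show "w k / of_nat ((2 * k) choose k) = w k * (1 + 2 * (\<Sum>n=1..N. cube_char n * central_ratio k n))"
      by (metis mult_1_right times_divide_eq_right)
  qed simp
  also have "\<dots> = (\<Sum>k=1..N. w k) + 2 * (\<Sum>k=1..N. \<Sum>n=1..N. cube_char n * (w k * central_ratio k n))"
    by (simp add: algebra_simps sum.distrib sum_distrib_left)
  also have "(\<Sum>k=1..N. \<Sum>n=1..N. cube_char n * (w k * central_ratio k n))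
      = (\<Sum>n=1..N. cube_char n * (\<Sum>k=1..N. w k * central_ratio k n))"
    unfolding sum_distrib_left by (rule sum.swap)
  finally show ?thesis .
qed

lemma prod_one_minus_square_diff:
  assumes "k \<ge> 1"
  shows "(\<Prod>i=1..k. 1 - a ^ 2 / of_nat i ^ 2) - (\<Prod>i=1..k - 1. 1 - a ^ 2 / of_nat i ^ 2)
       = - (a ^ 2 / of_nat k ^ 2) * (\<Prod>i=1..k - 1. 1 - a ^ 2 / (of_nat i :: rat) ^ 2)"
proof -
  obtain j where "k = Suc j" using assms by (cases k) auto
  then show ?thesis by (simp add: algebra_simps del: of_nat_Suc)
qed

text \<open>After \<open>sum_div_central_choose\<close> every inner sum telescopes, and n^2 times
  the whole sum becomes 1 - X(n-1) (1 + 2 \<Sigma>) with \<Sigma> the sum of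
  \<open>cube_char m * central_ratio n m\<close> over m < n. With C = 2n choose n, the bracket is
  2/C and X(n-1) is C/2, so everything cancels.\<close>

lemma sum_prod_div_central_choose_eq_0:
  assumes "odd n" "\<not> 3 dvd n"
  shows "(\<Sum>k=1..n - 1. (\<Prod>i=1..k - 1. 1 - of_nat n ^ 2 / of_nat i ^ 2) / of_nat k ^ 2 / of_nat ((2 * k) choose k)) = (0::rat)"
proof -
  define a X where "a = (of_nat n :: rat)" and "X = (\<lambda>k. \<Prod>i=1..k. 1 - a ^ 2 / of_nat i ^ 2)"
  let ?N = "n - 1"
  have n: "n > 0" and a: "a \<noteq> 0" using assms(1) by (auto simp: a_def intro: Nat.gr0I)
  have diff: "X k - X (k - 1) = - (a ^ 2 / of_nat k ^ 2) * X (k - 1)" if "k \<ge> 1" for k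
    unfolding X_def using that by (rule prod_one_minus_square_diff)
  have base: "a ^ 2 * (\<Sum>k=1..?N. X (k - 1) / of_nat k ^ 2) = 1 - X ?N"
  proof -
    have "a ^ 2 * (\<Sum>k=1..?N. X (k - 1) / of_nat k ^ 2) = (\<Sum>k=1..?N. X (k - 1) - X k)"
      unfolding sum_distrib_left
    proof (rule sum.cong)
      fix k assume "k \<in> {1..?N}"
      then show "a ^ 2 * (X (k - 1) / of_nat k ^ 2) = X (k - 1) - X k"
        using diff[of k] by (simp add: algebra_simps)
    qed simp
    also have "(\<Sum>k=1..m. X (k - 1) - X k) = X 0 - X m" for m
      by (induction m) auto
    finally show ?thesis by (simp add: X_def)
  qed
  have inner: "a ^ 2 * (\<Sum>k=1..?N. X (k - 1) / of_nat k ^ 2 * central_ratio k m) = - (central_ratio n m * X ?N)"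
    if m: "m \<in> {1..?N}" for m
  proof -
    define c where "c = (of_nat m :: rat)"
    have ne: "c ^ 2 - a ^ 2 \<noteq> 0"
    proof -
      have "m ^ 2 < n ^ 2" using m by (intro power_strict_mono) auto
      then have "of_nat (m ^ 2) \<noteq> (of_nat (n ^ 2) :: rat)" by (metis of_nat_eq_iff less_irrefl)
      then show ?thesis by (simp add: c_def a_def)
    qed
    \<comment> \<open>The recurrence of \<open>X\<close> turns the telescoping summand into (c^2 -
      a^2) times the wanted one.\<close>
    have "(c ^ 2 - a ^ 2) * (\<Sum>k=1..?N. X (k - 1) / of_nat k ^ 2 * central_ratio k m)
       = (\<Sum>k=1..?N. central_ratio k m * (c ^ 2 / of_nat k ^ 2 * X (k - 1) + (X k - X (k - 1))))"
      unfolding sum_distrib_left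
    proof (rule sum.cong)
      fix k assume "k \<in> {1..?N}"
      then have d: "X k - X (k - 1) = - (a ^ 2 / of_nat k ^ 2) * X (k - 1)" by (intro diff) simp
      show "(c ^ 2 - a ^ 2) * (X (k - 1) / of_nat k ^ 2 * central_ratio k m)
          = central_ratio k m * (c ^ 2 / of_nat k ^ 2 * X (k - 1) + (X k - X (k - 1)))"
        unfolding d by (simp add: algebra_simps diff_divide_distrib)
    qed simp
    also have "\<dots> = central_ratio ?N m * X ?N"
      unfolding c_def using m by (intro central_ratio_telescope) auto
    \<comment> \<open>Moving from n - 1 to n produces a factor c^2 - a^2 on this side too; it
      cancels and leaves -1/a^2.\<close>
    also have "central_ratio ?N m = (1 - c ^ 2 / a ^ 2) * central_ratio n m"
      using central_ratio_Suc[of ?N m] n by (simp add: a_def c_def)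
    also have "1 - c ^ 2 / a ^ 2 = (c ^ 2 - a ^ 2) * (- 1 / a ^ 2)"
      using a by (simp add: field_simps)
    also have "(c ^ 2 - a ^ 2) * (- 1 / a ^ 2) * central_ratio n m * X ?N
       = (c ^ 2 - a ^ 2) * (- (central_ratio n m * X ?N) / a ^ 2)"
      by simp
    finally have "(\<Sum>k=1..?N. X (k - 1) / of_nat k ^ 2 * central_ratio k m) = - (central_ratio n m * X ?N) / a ^ 2"
      unfolding mult_left_cancel[OF ne] .
    then show ?thesis using a by simp
  qed
  \<comment> \<open>As n is odd, the sign (-1)^(n-1) from the binomial form of the product is
    1.\<close>
  have top: "X ?N = of_nat ((2 * n) choose n) / 2"
  proof -
    have "X ?N = of_nat (n + (n - 1) choose (n - 1))"
      unfolding X_def a_def using prod_one_minus_square_eq_binomial[of "n - 1" n] n assms(1) by simp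
    also have "n + (n - 1) choose (n - 1) = (2 * n - 1) choose n"
      using n binomial_symmetric[of "n - 1" "n + (n - 1)"] by (simp add: mult_2)
    also have "2 * ((2 * n - 1) choose n) = (2 * n) choose n"
      using n Suc_times_binomial_eq[of "2 * n - 1" "n - 1"] binomial_symmetric[of n "2 * n - 1"]
      by (cases n) (simp_all add: mult_2)
    then have "of_nat ((2 * n - 1) choose n) = (of_nat ((2 * n) choose n) / 2 :: rat)"
      by (metis nonzero_mult_div_cancel_left of_nat_mult of_nat_numeral zero_neq_numeral)
    finally show ?thesis .
  qed
  let ?C = "of_nat ((2 * n) choose n) :: rat"
  have "1 / ?C = 1 + 2 * (\<Sum>m=1..n. cube_char m * central_ratio n m)"
    by (rule inverse_central_choose) simp
  \<comment> \<open>The expansion of 1/C runs up to m = n. Its last term is -1/(2C) because 3 does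
    not divide n, and moving it to the left doubles 1/C.\<close>
  also have "(\<Sum>m=1..n. cube_char m * central_ratio n m)
      = (\<Sum>m=1..?N. cube_char m * central_ratio n m) - 1 / (2 * ?C)"
  proof -
    have "cube_char n = - 1 / 2" using assms(2) by (simp add: cube_char_def)
    moreover have "central_ratio n n = 1 / ?C" by (simp add: central_ratio_def flip: mult_2)
    ultimately show ?thesis using n by (cases n) simp_all
  qed
  finally have tot: "1 + 2 * (\<Sum>m=1..?N. cube_char m * central_ratio n m) = 2 / ?C" by simp
  have "a ^ 2 * (\<Sum>k=1..?N. X (k - 1) / of_nat k ^ 2 / of_nat ((2 * k) choose k))
      = a ^ 2 * (\<Sum>k=1..?N. X (k - 1) / of_nat k ^ 2)
        + 2 * (\<Sum>m=1..?N. cube_char m * (a ^ 2 * (\<Sum>k=1..?N. X (k - 1) / of_nat k ^ 2 * central_ratio k m)))"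
    unfolding sum_div_central_choose by (simp add: algebra_simps sum_distrib_left)
  also have "\<dots> = 1 - X ?N + 2 * (\<Sum>m=1..?N. cube_char m * (- (central_ratio n m * X ?N)))"
    unfolding base by (intro arg_cong2[where f = "(+)"] arg_cong2[where f = "(*)"] sum.cong refl inner)
  also have "\<dots> = 1 - X ?N * (1 + 2 * (\<Sum>m=1..?N. cube_char m * central_ratio n m))"
    by (simp add: algebra_simps sum_distrib_left sum_negf)
  also have "\<dots> = 0" unfolding tot top by simp
  finally show ?thesis using a by (simp add: X_def a_def)
qed

text \<open>In the difference of the j-th summands a factor j appears and cancels the denominator,
  leaving 1/n + 1/(n+1) times the summand of \<open>sum_alternating_binomial_prod\<close>.\<close>

lemma alternating_binomial_sum_diff:
  assumes "n \<ge> 1"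
  shows "(\<Sum>j=1..n. (-1) ^ j * of_nat (n choose j) * of_nat (n + 1 + j choose j) / of_nat j)
       - (\<Sum>j=1..n - 1. (-1) ^ j * of_nat (n - 1 choose j) * of_nat (n + j choose j) / of_nat j)
       = (1 / of_nat n + 1 / of_nat (n + 1)) * ((-1) ^ n - 1 :: rat)"
proof -
  define x where "x = (of_nat n :: rat)"
  have x: "x \<noteq> 0" "x + 1 \<noteq> 0" using assms by (auto simp: x_def simp flip: of_nat_Suc)
  \<comment> \<open>The second sum may be extended to j = n since n - 1 choose n is 0.\<close>
  have "(\<Sum>j=1..n - 1. (-1) ^ j * of_nat (n - 1 choose j) * of_nat (n + j choose j) / of_nat j)
      = (\<Sum>j=1..n. (-1) ^ j * of_nat (n - 1 choose j) * of_nat (n + j choose j) / (of_nat j :: rat))"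
    by (rule sum.mono_neutral_left) (auto simp: binomial_eq_0)
  then have "(\<Sum>j=1..n. (-1) ^ j * of_nat (n choose j) * of_nat (n + 1 + j choose j) / of_nat j)
       - (\<Sum>j=1..n - 1. (-1) ^ j * of_nat (n - 1 choose j) * of_nat (n + j choose j) / of_nat j)
     = (\<Sum>j=1..n. (-1) ^ j * of_nat (n choose j) * of_nat (n + 1 + j choose j) / of_nat j
       - (-1) ^ j * of_nat (n - 1 choose j) * of_nat (n + j choose j) / (of_nat j :: rat))"
    by (simp add: sum_subtractf)
  also have "\<dots> = (\<Sum>j=1..n. (1 / x + 1 / (x + 1)) * ((-1) ^ j * of_nat (n choose j) * of_nat (n + j choose j)))"
  proof (rule sum.cong)
    fix j assume j: "j \<in> {1..n}"
    define y A B where "y = (of_nat j :: rat)" and "A = (of_nat (n choose j) :: rat)"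
      and "B = (of_nat (n + j choose j) :: rat)"
    have y: "y \<noteq> 0" using j by (auto simp: y_def)
    have "n * (n - 1 choose j) = (n - j) * (n choose j)" by (simp add: binomial_absorb_comp)
    then have "x * of_nat (n - 1 choose j) = of_nat (n - j) * A"
      unfolding x_def A_def by (metis of_nat_mult)
    then have 1: "of_nat (n - 1 choose j) = (x - y) * A / x"
      using j x by (simp add: of_nat_diff x_def[symmetric] y_def[symmetric] field_simps)
    have "(n + 1) * (n + 1 + j choose (n + 1)) = (n + 1 + j) * (n + j choose n)"
      using Suc_times_binomial_eq[of "n + j" n] by simp
    moreover have "(n + 1 + j choose (n + 1)) = (n + 1 + j choose j)" "(n + j choose n) = (n + j choose j)"
      using binomial_symmetric[of j "n + 1 + j"] binomial_symmetric[of j "n + j"] by simp_all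
    ultimately have "(n + 1) * (n + 1 + j choose j) = (n + 1 + j) * (n + j choose j)" by simp
    then have "of_nat (n + 1) * of_nat (n + 1 + j choose j) = of_nat (n + 1 + j) * B"
      unfolding B_def by (metis of_nat_mult)
    then have 2: "of_nat (n + 1 + j choose j) = (x + 1 + y) * B / (x + 1)"
      using x by (simp add: x_def[symmetric] y_def[symmetric] field_simps)
    have "A * ((x + 1 + y) * B / (x + 1)) / y - ((x - y) * A / x) * B / y = (1 / x + 1 / (x + 1)) * (A * B)"
    proof -
      have "(x + 1 + y) / (x + 1) = 1 + y / (x + 1)" "(x - y) / x = 1 - y / x"
        using x by (simp_all add: add_divide_distrib diff_divide_distrib)
      moreover have "A * ((x + 1 + y) * B / (x + 1)) / y - ((x - y) * A / x) * B / y
          = A * B * (((x + 1 + y) / (x + 1) - (x - y) / x) / y)"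
        by (simp add: diff_divide_distrib right_diff_distrib mult_ac)
      moreover have "(1 + y / (x + 1) - (1 - y / x)) / y = 1 / x + 1 / (x + 1)"
        using y by (simp add: add_divide_distrib)
      ultimately show ?thesis by (simp only: mult.commute)
    qed
    then have "(-1) ^ j * (A * ((x + 1 + y) * B / (x + 1)) / y - ((x - y) * A / x) * B / y)
        = (-1) ^ j * ((1 / x + 1 / (x + 1)) * (A * B))" by (rule arg_cong)
    then show "(-1) ^ j * of_nat (n choose j) * of_nat (n + 1 + j choose j) / of_nat j
       - (-1) ^ j * of_nat (n - 1 choose j) * of_nat (n + j choose j) / of_nat j
       = (1 / x + 1 / (x + 1)) * ((-1) ^ j * of_nat (n choose j) * of_nat (n + j choose j))"
      unfolding 1 2 A_def[symmetric] B_def[symmetric] y_def[symmetric] by (simp only: right_diff_distrib) (simp add: mult_ac)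
  qed simp
  also have "\<dots> = (1 / x + 1 / (x + 1)) * (\<Sum>j=1..n. (-1) ^ j * of_nat (n choose j) * of_nat (n + j choose j))"
    by (simp add: sum_distrib_left)
  also have "(\<Sum>j=1..n. (-1) ^ j * of_nat (n choose j) * of_nat (n + j choose j)) = ((-1) ^ n - 1 :: rat)"
  proof -
    have "{..n} = insert 0 {1..n}" by auto
    then show ?thesis using sum_alternating_binomial_prod[of n] by simp
  qed
  finally show ?thesis by (simp add: x_def add.commute)
qed

text \<open>In binomial form the sum makes sense for every n, with increments from
  \<open>alternating_binomial_sum_diff\<close>. These are 0 for even n and -2 (1/n + 1/(n+1)) for
  odd n, so two steps at a time add two harmonic terms.\<close>

lemma sum_prod_div_eq_harm:
  assumes "odd n"
  shows "(\<Sum>j=1..n - 1. (\<Prod>i=1..j. 1 - of_nat n ^ 2 / of_nat i ^ 2) / of_nat j) = - 2 * gen_harm 1 (n - 1)"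
proof -
  define f :: "nat \<Rightarrow> rat" where
    "f n = (\<Sum>j=1..n - 1. (-1) ^ j * of_nat (n - 1 choose j) * of_nat (n + j choose j) / of_nat j)" for n
  have step: "f (n + 1) = f n + (1 / of_nat n + 1 / of_nat (n + 1)) * ((-1) ^ n - 1)" if "n \<ge> 1" for n
    using alternating_binomial_sum_diff[OF that] by (simp add: f_def)
  have f: "f (2 * m + 1) = - 2 * gen_harm 1 (2 * m)" for m
  proof (induction m)
    case 0
    show ?case by (simp add: f_def gen_harm_def)
  next
    case (Suc m)
    have "f (2 * Suc m + 1) = f (2 * m + 1) - 2 / of_nat (2 * m + 1) - 2 / of_nat (2 * m + 2)"
      using step[of "2 * m + 1"] step[of "2 * m + 2"] by simp
    then show ?case unfolding Suc by (simp add: gen_harm_def)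
  qed
  have "(\<Sum>j=1..n - 1. (\<Prod>i=1..j. 1 - of_nat n ^ 2 / of_nat i ^ 2) / of_nat j) = f n"
    unfolding f_def
  proof (rule sum.cong)
    fix j assume "j \<in> {1..n - 1}"
    then have "j < n" by auto
    then show "(\<Prod>i=1..j. 1 - of_nat n ^ 2 / of_nat i ^ 2) / of_nat j
        = (-1) ^ j * of_nat (n - 1 choose j) * of_nat (n + j choose j) / (of_nat j :: rat)"
      by (simp only: prod_one_minus_square_eq_binomial)
  qed simp
  also obtain m where "n = 2 * m + 1" using assms by (rule oddE)
  then have "f n = - 2 * gen_harm 1 (n - 1)" using f by simp
  finally show ?thesis .
qed

section \<open>Apery's finite identity for zeta(2)\<close>

text \<open>Induction on n. The change of each summand \<open>t n k\<close> of the correction sum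
  under n -> n + 1 is a difference in k, so only boundary terms survive.\<close>

lemma apery_like_identity:
  "3 * (\<Sum>k=1..n. 1 / (of_nat k ^ 2 * of_nat ((2 * k) choose k)))
     + (\<Sum>k=1..n. (-1) ^ (n + k) * fact (k - 1) ^ 2 * fact (n - k) / fact (n + k))
   = 2 * (\<Sum>k=1..n. (-1) ^ (k - 1) / (of_nat k ^ 2 :: rat))"
proof (induction n)
  case 0
  show ?case by simp
next
  case (Suc n)
  define N where "N = (of_nat (Suc n) :: rat)"
  have N: "N \<noteq> 0" by (simp add: N_def del: of_nat_Suc)
  \<comment> \<open>Up to the factor \<open>(-1) ^ Suc n * (2 / N)\<close>, this is the companion of
    \<open>t\<close> in the sense of Wilf and Zeilberger.\<close>
  define w :: "nat \<Rightarrow> rat" where "w k = (-1) ^ k * fact k ^ 2 * fact (n - k) / fact (Suc n + k)" for k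
  define t :: "nat \<Rightarrow> nat \<Rightarrow> rat" where "t n k = (-1) ^ (n + k) * fact (k - 1) ^ 2 * fact (n - k) / fact (n + k)" for n k
  have summand: "t (Suc n) k - t n k = (-1) ^ Suc n * (2 / N) * (w k - w (k - 1))" if k: "k \<in> {1..n}" for k
  proof -
    obtain j where j: "k = Suc j" using k by (cases k) auto
    obtain m where m: "n = k + m" using k le_Suc_ex by (metis atLeastAtMost_iff)
    define x y where "x = (of_nat k :: rat)" and "y = (of_nat m :: rat)"
    define a F G where "a = (fact j :: rat)" and "F = (fact m :: rat)" and "G = (fact (n + k) :: rat)"
    have Nx: "N = x + y + 1" by (simp add: N_def m x_def y_def)
    have nz: "G \<noteq> 0" "N + x \<noteq> 0" by (simp_all add: G_def N_def x_def flip: of_nat_add del: of_nat_Suc)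
    have e: "n - k = m" "Suc n - k = Suc m" "n - j = Suc m" "k - 1 = j" "Suc n + k = Suc (n + k)" "Suc n + j = n + k"
      using j m by auto
    have f: "fact (Suc m) = (y + 1) * F" "fact (Suc (n + k)) = (N + x) * G" "fact k = x * a"
      unfolding F_def G_def a_def by (simp_all add: y_def N_def x_def j algebra_simps)
    have s: "(-1) ^ Suc (n + k) = (-1) ^ Suc n * ((-1) ^ k :: rat)" "(-1) ^ (n + k) = - ((-1) ^ Suc n * ((-1) ^ k :: rat))"
      "(-1) ^ j = - ((-1) ^ k :: rat)"
      by (simp_all add: power_add j)
    define u where "u = (-1) ^ Suc n * ((-1) ^ k :: rat)"
    have "t (Suc n) k - t n k = u * (a ^ 2 * ((y + 1) * F) / ((N + x) * G) + a ^ 2 * F / G)"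
      unfolding t_def e s f F_def[symmetric] G_def[symmetric] a_def[symmetric] u_def[symmetric]
      by (simp add: algebra_simps)
    also have "a ^ 2 * ((y + 1) * F) / ((N + x) * G) + a ^ 2 * F / G
        = (2 / N) * ((x * a) ^ 2 * F / ((N + x) * G) + a ^ 2 * ((y + 1) * F) / G)"
    proof -
      have "y = N - x - 1" using Nx by simp
      then show ?thesis using nz N by (simp add: divide_simps) (simp add: algebra_simps power2_eq_square)
    qed
    also have "u * \<dots> = (-1) ^ Suc n * (2 / N) * ((-1) ^ k * ((x * a) ^ 2 * F / ((N + x) * G))
        - - ((-1) ^ k) * (a ^ 2 * ((y + 1) * F) / G))"
      unfolding u_def by (simp only: algebra_simps minus_minus)
    also have "\<dots> = (-1) ^ Suc n * (2 / N) * (w k - w (k - 1))"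
      unfolding w_def e s f F_def[symmetric] G_def[symmetric] a_def[symmetric] by simp
    finally show ?thesis .
  qed
  have "(\<Sum>k=1..n. t (Suc n) k) - (\<Sum>k=1..n. t n k) = (-1) ^ Suc n * (2 / N) * (\<Sum>k=1..n. w k - w (k - 1))"
    unfolding sum_subtractf[symmetric] sum_distrib_left by (rule sum.cong) (auto simp: summand)
  also have "(\<Sum>k=1..n. w k - w (k - 1)) = w n - w 0"
    by (induction n) auto
  also have "w 0 = 1 / N" by (simp add: w_def N_def)
  also have C: "1 / of_nat ((2 * Suc n) choose Suc n) = N * (fact n ^ 2 * N / fact (Suc n + Suc n))"
    by (subst binomial_fact) (simp_all add: N_def power2_eq_square mult_2 del: of_nat_Suc)
  have "w n = (-1) ^ n * (2 * N * fact n ^ 2 / fact (Suc n + Suc n))"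
  proof -
    have "fact (Suc n + Suc n) = 2 * N * (fact (Suc n + n) :: rat)" by (simp add: N_def)
    then show ?thesis unfolding w_def using N by simp
  qed
  also have "(-1) ^ Suc n * (2 / N) * ((-1) ^ n * (2 * N * fact n ^ 2 / fact (Suc n + Suc n)) - 1 / N)
      = - 4 * (fact n ^ 2 / fact (Suc n + Suc n)) + 2 * (-1) ^ n / N ^ 2"
  proof -
    have "(- s) * (2 / N) * (s * (2 * N * F / G) - 1 / N) = - 4 * (F / G) + 2 * s / N ^ 2"
      if "s * s = 1" for s F G :: rat
    proof -
      have "(- s) * (2 / N) * (s * (2 * N * F / G) - 1 / N) = - (s * s) * (4 * (F / G)) + 2 * s / (N * N)"
        using N by (simp add: algebra_simps)
      then show ?thesis using that by (simp add: power2_eq_square)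
    qed
    from this[of "(-1) ^ n"] show ?thesis by (simp del: fact_Suc add_Suc add_Suc_right flip: power_mult_distrib)
  qed
  finally have d: "(\<Sum>k=1..n. t (Suc n) k) - (\<Sum>k=1..n. t n k)
      = - 4 * (fact n ^ 2 / fact (Suc n + Suc n)) + 2 * (-1) ^ n / N ^ 2" .
  have "t (Suc n) (Suc n) = fact n ^ 2 / fact (Suc n + Suc n)" by (simp add: t_def)
  moreover have "1 / (N ^ 2 * of_nat ((2 * Suc n) choose Suc n)) = fact n ^ 2 / fact (Suc n + Suc n)"
  proof -
    have "1 / (N ^ 2 * of_nat ((2 * Suc n) choose Suc n)) = 1 / of_nat ((2 * Suc n) choose Suc n) / N ^ 2"
      by simp
    then show ?thesis unfolding C using N by (simp add: power2_eq_square)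
  qed
  \<comment> \<open>With F = n!^2 / (2n+2)!, the boundary contributes -4 F and the new diagonal term
    \<open>t (Suc n) (Suc n)\<close> contributes F. Their sum cancels the new term 3 F of the first
    sum, and 2 (-1)^n / N^2 is the increment on the right.\<close>
  ultimately show ?case using Suc d unfolding t_def[symmetric] N_def[symmetric]
    by (simp add: N_def[symmetric] algebra_simps del: of_nat_Suc binomial_Suc_Suc)
qed

text \<open>The factors n - k, ..., n + k - 1 of the quotient of factorials are n - k, n and the
  pairs (n - i)(n + i) with i < k. Dividing each pair by i^2 gives the product, up to sign.\<close>

lemma factorial_ratio_eq_prod:
  assumes "k \<ge> 1" "k < n"
  shows "of_nat n * (fact (k - 1) ^ 2 * fact (n - 1 - k) / fact (n - 1 + k))
       = (-1) ^ (k - 1) / ((of_nat n - of_nat k) * (\<Prod>i=1..k - 1. 1 - of_nat n ^ 2 / (of_nat i :: rat) ^ 2))"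
  using assms
proof (induction k rule: dec_induct)
  case base
  obtain m where "n = Suc (Suc m)" using base by (metis One_nat_def Suc_lessE less_imp_Suc_add add_Suc plus_1_eq_Suc)
  moreover have "fact (Suc (Suc m)) = (of_nat (Suc (Suc m)) * (of_nat (Suc m) * fact m) :: rat)"
    by (simp del: of_nat_Suc)
  ultimately show ?case by (simp del: fact_Suc of_nat_Suc)
next
  case (step k)
  obtain m where n: "n = Suc (k + Suc m)" using step.prems less_imp_Suc_add[of "Suc k" n] by auto
  obtain j where j: "k = Suc j" using step.hyps by (cases k) auto
  define x y where "x = (of_nat n :: rat)" and "y = (of_nat k :: rat)"
  have xy: "y \<noteq> 0" "x - y \<noteq> 0" "x - y - 1 \<noteq> 0" "x + y \<noteq> 0"
    using step.hyps by (auto simp: x_def y_def n simp flip: of_nat_add of_nat_Suc)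
  have z: "x - y - 1 = of_nat (Suc m)" by (simp add: x_def y_def n)
  define P where "P = (\<Prod>i=1..k - 1. 1 - of_nat n ^ 2 / (of_nat i :: rat) ^ 2)"
  have f: "n - 1 - k = Suc m" "n - 1 - Suc k = m" "n - 1 + Suc k = Suc (n - 1 + k)" "Suc (n - 1 + k) = n + k"
    by (simp_all add: n)
  have "fact (n - 1 + Suc k) = (x + y) * (fact (n - 1 + k) :: rat)"
    unfolding f(3) fact_Suc unfolding f(4) by (simp add: x_def y_def)
  then have "of_nat n * (fact (Suc k - 1) ^ 2 * fact (n - 1 - Suc k) / fact (n - 1 + Suc k))
      = of_nat n * (fact k ^ 2 * fact m / ((x + y) * fact (n - 1 + k)))"
    unfolding f(2) by simp
  also have "\<dots> = of_nat n * (fact (k - 1) ^ 2 * fact (n - 1 - k) / fact (n - 1 + k)) * (y ^ 2 / ((x + y) * (x - y - 1)))"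
  proof -
    have "fact k = y * (fact (k - 1) :: rat)" by (simp add: j y_def)
    then show ?thesis
      unfolding f(1) fact_Suc[of m] z[symmetric] using xy(3) by (simp add: power_mult_distrib mult_ac)
  qed
  also have "\<dots> = (-1) ^ (k - 1) / ((x - y) * P) * (y ^ 2 / ((x + y) * (x - y - 1)))"
    using step.IH step.prems by (simp add: P_def x_def y_def)
  also have "(\<Prod>i=1..Suc k - 1. 1 - of_nat n ^ 2 / (of_nat i :: rat) ^ 2) = P * (1 - x ^ 2 / y ^ 2)"
    by (simp add: P_def j x_def y_def)
  then have "(-1) ^ (k - 1) / ((x - y) * P) * (y ^ 2 / ((x + y) * (x - y - 1)))
     = (-1) ^ (Suc k - 1) / ((of_nat n - of_nat (Suc k)) * (\<Prod>i=1..Suc k - 1. 1 - of_nat n ^ 2 / (of_nat i :: rat) ^ 2))"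
  proof -
    have "1 - x ^ 2 / y ^ 2 = - ((x - y) * (x + y) / y ^ 2)"
      using xy(1) by (simp add: field_simps power2_eq_square)
    then show ?thesis
      unfolding \<open>(\<Prod>i=1..Suc k - 1. _ i) = _\<close> by (simp add: x_def y_def j mult_ac diff_diff_eq)
  qed
  finally show ?case .
qed

text \<open>\<open>apery_like_identity\<close> at n - 1; since n - 1 is even, all terms of the
  correction sum get the same sign.\<close>

lemma apery_like_identity_odd:
  assumes "odd n"
  shows "3 * (\<Sum>k=1..n - 1. 1 / (of_nat k ^ 2 * of_nat ((2 * k) choose k)))
   = 2 * (\<Sum>k=1..n - 1. (-1) ^ (k - 1) / of_nat k ^ 2)
     + (\<Sum>k=1..n - 1. 1 / ((of_nat n - of_nat k) * (\<Prod>i=1..k - 1. 1 - of_nat n ^ 2 / (of_nat i :: rat) ^ 2))) / of_nat n"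
proof -
  have n: "(of_nat n :: rat) \<noteq> 0" using assms by (auto intro: Nat.gr0I)
  have "of_nat n * (\<Sum>k=1..n - 1. (-1) ^ (n - 1 + k) * fact (k - 1) ^ 2 * fact (n - 1 - k) / fact (n - 1 + k))
     = - (\<Sum>k=1..n - 1. 1 / ((of_nat n - of_nat k) * (\<Prod>i=1..k - 1. 1 - of_nat n ^ 2 / (of_nat i :: rat) ^ 2)))"
    unfolding sum_distrib_left sum_negf[symmetric]
  proof (rule sum.cong)
    fix k assume "k \<in> {1..n - 1}"
    then have k: "k \<ge> 1" "k < n" by auto
    have "even (n - 1)" using assms by simp
    then have s: "(-1) ^ (n - 1 + k) * (-1) ^ (k - 1) = (-1 :: rat)"
      using k by (cases k) (auto simp: power_add simp flip: power_mult_distrib)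
    have "of_nat n * ((-1) ^ (n - 1 + k) * fact (k - 1) ^ 2 * fact (n - 1 - k) / fact (n - 1 + k))
      = (-1) ^ (n - 1 + k) * (of_nat n * (fact (k - 1) ^ 2 * fact (n - 1 - k) / fact (n - 1 + k)) :: rat)"
      by simp
    also have "\<dots> = (-1) ^ (n - 1 + k) * (-1) ^ (k - 1) / ((of_nat n - of_nat k) * (\<Prod>i=1..k - 1. 1 - of_nat n ^ 2 / (of_nat i :: rat) ^ 2))"
      unfolding factorial_ratio_eq_prod[OF k] by simp
    finally show "of_nat n * ((-1) ^ (n - 1 + k) * fact (k - 1) ^ 2 * fact (n - 1 - k) / fact (n - 1 + k))
      = - (1 / ((of_nat n - of_nat k) * (\<Prod>i=1..k - 1. 1 - of_nat n ^ 2 / (of_nat i :: rat) ^ 2)))"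
      unfolding s by simp
  qed simp
  then have "(\<Sum>k=1..n - 1. (-1) ^ (n - 1 + k) * fact (k - 1) ^ 2 * fact (n - 1 - k) / fact (n - 1 + k))
     = - (\<Sum>k=1..n - 1. 1 / ((of_nat n - of_nat k) * (\<Prod>i=1..k - 1. 1 - of_nat n ^ 2 / (of_nat i :: rat) ^ 2))) / of_nat n"
    using n by (simp add: field_simps)
  then show ?thesis using apery_like_identity[of "n - 1"] by simp
qed

section \<open>Symmetric functions of reciprocal squares\<close>

lemma gen_harm_0 [simp]: "gen_harm s 0 = 0"
  by (simp add: gen_harm_def)

lemma gen_harm_Suc: "gen_harm s (Suc n) = gen_harm s n + 1 / of_nat (Suc n) ^ s"
  by (simp add: gen_harm_def)

lemma sum_gen_harm_2_div_square:
  "(\<Sum>k=1..n. gen_harm 2 (k - 1) / of_nat k ^ 2) = (gen_harm 2 n ^ 2 - gen_harm 4 n) / 2"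
  by (induction n) (simp_all add: gen_harm_Suc add_divide_distrib diff_divide_distrib power2_sum power_divide
    del: of_nat_Suc flip: power_mult)

text \<open>The elementary and the complete homogeneous symmetric polynomial of degree 2
  in \<open>1, 1/4, \<dots>, 1/k\<^sup>2\<close>.\<close>

definition elem_harm_2 :: "nat \<Rightarrow> rat" where
  "elem_harm_2 k = (gen_harm 2 k ^ 2 - gen_harm 4 k) / 2"

definition hom_harm_2 :: "nat \<Rightarrow> rat" where
  "hom_harm_2 k = (gen_harm 2 k ^ 2 + gen_harm 4 k) / 2"

lemma elem_harm_2_Suc: "elem_harm_2 (Suc k) = elem_harm_2 k + gen_harm 2 k / of_nat (Suc k) ^ 2"
  by (simp add: elem_harm_2_def gen_harm_Suc add_divide_distrib diff_divide_distrib power2_sum power_divide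
    del: of_nat_Suc flip: power_mult)

lemma central_ratio_0 [simp]: "central_ratio k 0 = 1"
  by (simp add: central_ratio_def)

lemma central_ratio_Suc_right:
  assumes "n < k"
  shows "central_ratio k (Suc n) * of_nat (k + n + 1) = central_ratio k n * (of_nat k - of_nat n)"
proof -
  have "Suc (k + n) * ((2 * k) choose Suc (k + n)) = (2 * k - (k + n)) * ((2 * k) choose (k + n))"
    by (metis binomial_absorb_comp binomial_absorption)
  then have "of_nat (k + n + 1) * of_nat ((2 * k) choose (k + Suc n)) = (of_nat (2 * k - (k + n)) * of_nat ((2 * k) choose (k + n)) :: rat)"
    by (simp only: flip: of_nat_mult) simp
  moreover have "of_nat (2 * k - (k + n)) = (of_nat k - of_nat n :: rat)" using assms by (simp add: of_nat_diff)
  ultimately show ?thesis by (simp add: central_ratio_def mult.commute del: of_nat_add)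
qed

text \<open>If f has increments g(k) / (k+1)^2, then telescoping trades the weight f for the weight
  g at the price of a factor 1/n^2. Three rounds lead from \<open>elem_harm_2\<close> through
  \<open>gen_harm 2\<close> and 1 to 0.\<close>

lemma sum_elem_harm_2_central_ratio:
  assumes "n > 0"
  shows "(\<Sum>k=1..N. elem_harm_2 (k - 1) / of_nat k ^ 2 * central_ratio k n)
    = central_ratio N n * ((1 / of_nat n) ^ 6 - gen_harm 2 N * (1 / of_nat n) ^ 4 + elem_harm_2 N * (1 / of_nat n) ^ 2)"
proof -
  define T where "T f = (\<Sum>k=1..N. f (k - 1) / of_nat k ^ 2 * central_ratio k n)" for f :: "nat \<Rightarrow> rat"
  define u where "u = 1 / (of_nat n :: rat)"
  have T: "T f = u ^ 2 * (central_ratio N n * f N - T g)"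
    if "\<And>k. f (Suc k) = f k + g k / of_nat (Suc k) ^ 2" for f g
  proof -
    have "central_ratio N n * f N = (\<Sum>k=1..N. central_ratio k n * (of_nat n ^ 2 / of_nat k ^ 2 * f (k - 1) + (f k - f (k - 1))))"
      using central_ratio_telescope[OF assms] by simp
    also have "\<dots> = (\<Sum>k=1..N. of_nat n ^ 2 * (f (k - 1) / of_nat k ^ 2 * central_ratio k n) + g (k - 1) / of_nat k ^ 2 * central_ratio k n)"
    proof (rule sum.cong)
      fix k assume "k \<in> {1..N}"
      then obtain j where "k = Suc j" by (cases k) auto
      then show "central_ratio k n * (of_nat n ^ 2 / of_nat k ^ 2 * f (k - 1) + (f k - f (k - 1)))
        = of_nat n ^ 2 * (f (k - 1) / of_nat k ^ 2 * central_ratio k n) + g (k - 1) / of_nat k ^ 2 * central_ratio k n"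
        by (simp add: that algebra_simps del: of_nat_Suc)
    qed simp
    also have "\<dots> = of_nat n ^ 2 * T f + T g" by (simp add: T_def sum.distrib sum_distrib_left)
    finally have "of_nat n ^ 2 * T f = central_ratio N n * f N - T g" by simp
    then show ?thesis using assms by (simp add: u_def power_one_over field_simps)
  qed
  have "T elem_harm_2 = u ^ 2 * (central_ratio N n * elem_harm_2 N - T (gen_harm 2))"
    by (rule T) (rule elem_harm_2_Suc)
  also have "T (gen_harm 2) = u ^ 2 * (central_ratio N n * gen_harm 2 N - T (\<lambda>_. 1))"
    by (rule T) (simp add: gen_harm_Suc)
  also have "T (\<lambda>_. 1) = u ^ 2 * (central_ratio N n * 1 - T (\<lambda>_. 0))"
    by (rule T) simp
  also have "T (\<lambda>_. 0) = 0" by (simp add: T_def)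
  finally show ?thesis unfolding T_def u_def[symmetric]
    by (simp add: algebra_simps power_numeral_reduce)
qed

text \<open>\<open>hex_char n = cos (\<pi> n / 3)\<close>.\<close>

definition hex_char :: "nat \<Rightarrow> rat" where
  "hex_char n = (-1) ^ n * cube_char n"

lemma hex_char_add_6: "hex_char (6 * m + n) = hex_char n"
  using cube_char_shift[of "2 * m" n] by (simp add: hex_char_def power_add power_mult)

lemma hex_char_reflect: "n \<le> 6 * m \<Longrightarrow> hex_char (6 * m - n) = hex_char n"
  using cube_char_reflect[of n "2 * m"] by (simp add: hex_char_def minus_one_power_iff)

text \<open>Written with divisibility indicators, a sum weighted by \<open>hex_char\<close> splits
  into unweighted sums over the multiples of 1, 2, 3 and 6.\<close>

lemma hex_char_eq:
  "hex_char n = 1 / 2 - (if 2 dvd n then 1 else 0) - (if 3 dvd n then 3 / 2 else 0) + (if 6 dvd n then 3 else 0)"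
proof -
  have "6 dvd n \<longleftrightarrow> 2 dvd n \<and> 3 dvd n" by presburger
  then show ?thesis by (simp add: hex_char_def cube_char_def minus_one_power_iff)
qed

text \<open>Faulhaber's formula: multiply the geometric sum of the exp(kx), k < N, by x = B(x)
  (exp(x) - 1), with B the generating function of the Bernoulli numbers, and compare coefficients of
  x^(m+1).\<close>

lemma sum_powers_bernoulli:
  "(\<Sum>k<N. of_nat k ^ m) / fact m
    = (\<Sum>i\<le>m. bernoulli i / fact i * (of_nat N ^ (m + 1 - i) / fact (m + 1 - i)))"
proof -
  define B where "B = Abs_fps (\<lambda>n. bernoulli n / fact n)"
  have geometric: "fps_exp (of_nat N) - 1 = (\<Sum>k<N. fps_exp (of_nat k)) * (fps_exp (1::rat) - 1)"
  proof (induction N)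
    case 0
    show ?case by simp
  next
    case (Suc N)
    have "fps_exp (of_nat (Suc N)) = fps_exp (of_nat N) * fps_exp (1::rat)"
      by (simp add: fps_exp_add_mult add.commute)
    moreover have "(\<Sum>k<Suc N. fps_exp (of_nat k)) * (fps_exp (1::rat) - 1)
        = (fps_exp (of_nat N) - 1) + fps_exp (of_nat N) * (fps_exp (1::rat) - 1)"
      unfolding Suc by (simp add: distrib_right)
    ultimately show ?case by (simp add: right_diff_distrib)
  qed
  have "B * (fps_exp (of_nat N) - 1) = (\<Sum>k<N. fps_exp (of_nat k)) * (B * (fps_exp 1 - 1))"
    unfolding geometric by (rule mult.left_commute)
  also have "B * (fps_exp 1 - 1) = fps_X"
    unfolding B_def by (rule bernoulli_egf)
  finally have "B * (fps_exp (of_nat N) - 1) = fps_X * (\<Sum>k<N. fps_exp (of_nat k))"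
    by (simp only: mult.commute)
  then have "fps_nth (B * (fps_exp (of_nat N) - 1)) (Suc m) = fps_nth (fps_X * (\<Sum>k<N. fps_exp (of_nat k))) (Suc m)"
    by simp
  also have "\<dots> = (\<Sum>k<N. of_nat k ^ m) / fact m"
    by (simp add: fps_sum_nth sum_divide_distrib)
  also have "fps_nth (B * (fps_exp (of_nat N) - 1)) (Suc m)
     = (\<Sum>i=0..Suc m. bernoulli i / fact i * fps_nth (fps_exp (of_nat N) - 1) (Suc m - i))"
    by (simp add: fps_mult_nth B_def)
  \<comment> \<open>The term i = m + 1 drops out, as exp(Nx) - 1 has constant coefficient 0.\<close>
  also have "\<dots> = (\<Sum>i\<le>m. bernoulli i / fact i * (of_nat N ^ (m + 1 - i) / fact (m + 1 - i)))"
    unfolding atMost_atLeast0 sum.atLeast0_atMost_Suc by (auto intro!: sum.cong)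
  finally show ?thesis by simp
qed

section \<open>Congruences for harmonic numbers\<close>

locale prime_gt_5 =
  fixes p :: nat
  assumes prime_p: "prime p" and p_gt_5: "p > 5"
begin

section \<open>The ring of p-integral rationals\<close>

abbreviation P :: rat where "P \<equiv> of_nat p"

text \<open>The localization of the integers at p. A zero denominator is excluded automatically,
  since p divides 0.\<close>

definition Zp :: "rat set" where
  "Zp = {x. \<exists>a b. x = of_int a / of_int b \<and> \<not> int p dvd b}"

lemma prime_int_p: "prime (int p)" using prime_p by simp

lemma p_neq_0 [simp]: "p \<noteq> 0" using p_gt_5 by simp

lemma odd_p: "odd p" using prime_p p_gt_5 prime_odd_nat by auto

lemma ZpI: "\<not> int p dvd b \<Longrightarrow> of_int a / of_int b \<in> Zp"
  unfolding Zp_def by blast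

lemma Zp_divide_int:
  assumes "x \<in> Zp" "\<not> int p dvd n"
  shows "x / of_int n \<in> Zp"
proof -
  obtain a b where "x = of_int a / of_int b" "\<not> int p dvd b" using assms(1) by (auto simp: Zp_def)
  moreover have "\<not> int p dvd b * n"
    using calculation(2) assms(2) prime_int_p by (simp add: prime_dvd_mult_iff)
  ultimately show ?thesis using ZpI[of "b * n" a] by simp
qed

lemma Zp_of_int [simp]: "of_int a \<in> Zp"
  using ZpI[of 1 a] p_gt_5 by simp

lemma Zp_of_nat [simp]: "of_nat a \<in> Zp"
  using Zp_of_int[of "int a"] by simp

lemma Zp_0 [simp]: "0 \<in> Zp" using Zp_of_int[of 0] by simp
lemma Zp_1 [simp]: "1 \<in> Zp" using Zp_of_int[of 1] by simp
lemma Zp_numeral [simp]: "numeral n \<in> Zp" using Zp_of_int[of "numeral n"] by simp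

lemma Zp_add [simp]:
  assumes "x \<in> Zp" "y \<in> Zp"
  shows "x + y \<in> Zp"
proof -
  obtain a b c d where x: "x = of_int a / of_int b" "\<not> int p dvd b"
    and y: "y = of_int c / of_int d" "\<not> int p dvd d"
    using assms by (auto simp: Zp_def)
  then have "b \<noteq> 0" "d \<noteq> 0" by auto
  then have "x + y = of_int (a * d + c * b) / of_int b / of_int d"
    unfolding x y by (simp add: field_simps)
  also have "\<dots> \<in> Zp" using x y by (intro Zp_divide_int Zp_of_int)
  finally show ?thesis .
qed

lemma Zp_mult [simp]:
  assumes "x \<in> Zp" "y \<in> Zp"
  shows "x * y \<in> Zp"
proof -
  obtain a b where y: "y = of_int a / of_int b" "\<not> int p dvd b"
    using assms by (auto simp: Zp_def)
  obtain c d where x: "x = of_int c / of_int d" "\<not> int p dvd d"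
    using assms by (auto simp: Zp_def)
  have "x * y = of_int (a * c) / of_int b / of_int d"
    unfolding x y by (simp add: mult.commute)
  also have "\<dots> \<in> Zp" using x y by (intro Zp_divide_int Zp_of_int)
  finally show ?thesis .
qed

lemma Zp_uminus [simp]: "x \<in> Zp \<Longrightarrow> - x \<in> Zp"
  using Zp_mult[of "-1" x] Zp_of_int[of "-1"] by simp

lemma Zp_diff [simp]: "x \<in> Zp \<Longrightarrow> y \<in> Zp \<Longrightarrow> x - y \<in> Zp"
  using Zp_add[of x "- y"] by simp

lemma Zp_power [simp]: "x \<in> Zp \<Longrightarrow> x ^ n \<in> Zp"
  by (induction n) auto

lemma Zp_sum [simp]: "(\<And>i. i \<in> A \<Longrightarrow> f i \<in> Zp) \<Longrightarrow> sum f A \<in> Zp"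
  by (induction A rule: infinite_finite_induct) auto

lemma Zp_prod [simp]: "(\<And>i. i \<in> A \<Longrightarrow> f i \<in> Zp) \<Longrightarrow> prod f A \<in> Zp"
  by (induction A rule: infinite_finite_induct) auto

lemma Zp_divide_nat: "x \<in> Zp \<Longrightarrow> \<not> p dvd n \<Longrightarrow> x / of_nat n \<in> Zp"
  using Zp_divide_int[of x "int n"] by simp

lemma Zp_divide_less: "x \<in> Zp \<Longrightarrow> 0 < n \<Longrightarrow> n < p \<Longrightarrow> x / of_nat n \<in> Zp"
  using Zp_divide_nat nat_dvd_not_less by blast

lemma Zp_half [simp]: "x \<in> Zp \<Longrightarrow> x / 2 \<in> Zp"
  and Zp_third [simp]: "x \<in> Zp \<Longrightarrow> x / 3 \<in> Zp"
  and Zp_fifth [simp]: "x \<in> Zp \<Longrightarrow> x / 5 \<in> Zp"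
  using Zp_divide_less[of x 2] Zp_divide_less[of x 3] Zp_divide_less[of x 5] p_gt_5 by auto

lemma Zp_inverse [simp]: "0 < k \<Longrightarrow> k < p \<Longrightarrow> 1 / of_nat k \<in> Zp"
  by (rule Zp_divide_less) auto

lemma Zp_inverse_shift:
  assumes "0 < k" "k < p"
  shows "1 / (of_int c * P - of_nat k) \<in> Zp"
proof -
  have "\<not> int p dvd c * int p - int k"
    using assms by (metis dvd_diff_right_iff dvd_triv_right int_dvd_int_iff nat_dvd_not_less)
  then have "1 / of_int (c * int p - int k) \<in> Zp" by (intro Zp_divide_int) auto
  then show ?thesis by simp
qed

section \<open>Congruences modulo powers of p\<close>

text \<open>Only the difference has to lie in p^r \<open>Zp\<close>; neither side need be
  p-integral, just as in the final congruence.\<close>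

definition pcong :: "nat \<Rightarrow> rat \<Rightarrow> rat \<Rightarrow> bool" where
  "pcong r a b \<longleftrightarrow> (\<exists>z\<in>Zp. a = b + P ^ r * z)"

lemma pcongI: "a = b + P ^ r * z \<Longrightarrow> z \<in> Zp \<Longrightarrow> pcong r a b"
  unfolding pcong_def by blast

lemma pcongE:
  assumes "pcong r a b"
  obtains z where "z \<in> Zp" "a = b + P ^ r * z"
  using assms unfolding pcong_def by blast

lemma pcong_refl [simp]: "pcong r a a"
  by (rule pcongI[of _ _ _ 0]) auto

lemma pcong_sym: "pcong r a b \<Longrightarrow> pcong r b a"
  by (elim pcongE, rule pcongI[of _ _ _ "- z" for z]) auto

lemma pcong_trans [trans]:
  assumes "pcong r a b" "pcong r b c"
  shows "pcong r a c"
proof -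
  obtain x y where "x \<in> Zp" "y \<in> Zp" "a = b + P ^ r * x" "b = c + P ^ r * y"
    using assms by (elim pcongE) blast
  then show ?thesis by (intro pcongI[of _ _ _ "x + y"]) (auto simp: algebra_simps)
qed

lemma pcong_add:
  assumes "pcong r a b" "pcong r c d"
  shows "pcong r (a + c) (b + d)"
proof -
  obtain x y where "x \<in> Zp" "y \<in> Zp" "a = b + P ^ r * x" "c = d + P ^ r * y"
    using assms by (elim pcongE) blast
  then show ?thesis by (intro pcongI[of _ _ _ "x + y"]) (auto simp: algebra_simps)
qed

lemma pcong_cmult: "pcong r a b \<Longrightarrow> c \<in> Zp \<Longrightarrow> pcong r (c * a) (c * b)"
proof (elim pcongE)
  fix z assume "c \<in> Zp" "z \<in> Zp" "a = b + P ^ r * z"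
  then show ?thesis by (intro pcongI[of _ _ _ "c * z"]) (auto simp: algebra_simps)
qed

lemma pcong_uminus: "pcong r a b \<Longrightarrow> pcong r (- a) (- b)"
  using pcong_cmult[of r a b "-1"] by simp

lemma pcong_diff: "pcong r a b \<Longrightarrow> pcong r c d \<Longrightarrow> pcong r (a - c) (b - d)"
  using pcong_add[of r a b "- c" "- d"] pcong_uminus[of r c d] by simp

lemma pcong_mult:
  assumes "pcong r a b" "pcong r c d" "b \<in> Zp" "c \<in> Zp"
  shows "pcong r (a * c) (b * d)"
proof -
  have "pcong r (a * c) (b * c)" using pcong_cmult[OF assms(1,4)] by (simp only: mult.commute)
  also have "pcong r (b * c) (b * d)" using pcong_cmult[OF assms(2,3)] .
  finally show ?thesis .
qed

lemma pcong_Zp: "pcong r a b \<Longrightarrow> b \<in> Zp \<Longrightarrow> a \<in> Zp"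
  by (elim pcongE) auto

lemma pcong_power:
  assumes "pcong r a b" "b \<in> Zp"
  shows "pcong r (a ^ n) (b ^ n)"
  using assms pcong_Zp[OF assms] by (induction n) (auto intro!: pcong_mult)

lemma pcong_sum: "(\<And>i. i \<in> A \<Longrightarrow> pcong r (f i) (g i)) \<Longrightarrow> pcong r (sum f A) (sum g A)"
  by (induction A rule: infinite_finite_induct) (auto intro: pcong_add)

text \<open>Clear denominators: for x - y = n/d in lowest terms, n b = p^r a d with b prime to p.
  Hence p^r divides n, and p dividing d would force p to divide n as well, against
  coprimality.\<close>

lemma rat_cong_of_pcong:
  assumes "pcong r x y"
  shows "rat_cong p r x y"
proof (cases "x = y")
  case False
  obtain z where z: "z \<in> Zp" "x = y + P ^ r * z" using assms by (elim pcongE)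
  obtain a b where ab: "z = of_int a / of_int b" "\<not> int p dvd b" using z(1) by (auto simp: Zp_def)
  obtain n d where nd: "quotient_of (x - y) = (n, d)" by fastforce
  have d: "d > 0" and cop: "coprime n d" and xy: "x - y = of_int n / of_int d"
    using quotient_of_denom_pos[OF nd] quotient_of_coprime[OF nd] quotient_of_div[OF nd] by auto
  have unit: "\<not> is_unit (int p)" using prime_int_p not_prime_unit by blast
  have n: "n \<noteq> 0" using False xy by auto
  have "b \<noteq> 0" using ab(2) by auto
  have "of_int n / of_int d = P ^ r * of_int a / (of_int b :: rat)" using z(2) ab(1) xy by simp
  then have "of_int (n * b) = (of_int (int p ^ r * a * d) :: rat)"
    using d \<open>b \<noteq> 0\<close> by (simp add: field_simps)
  then have eq: "n * b = int p ^ r * a * d" by (simp only: of_int_eq_iff)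
  have "coprime (int p ^ r) b"
    using ab(2) prime_int_p by (simp add: prime_imp_coprime)
  moreover have "int p ^ r dvd n * b" using eq by (metis dvd_triv_left mult.assoc)
  ultimately have "int p ^ r dvd n" by (simp add: coprime_dvd_mult_left_iff)
  then have "r \<le> multiplicity (int p) n"
    by (rule multiplicity_geI[OF n unit])
  moreover have "multiplicity (int p) d = 0"
  proof (rule ccontr)
    assume "multiplicity (int p) d \<noteq> 0"
    then have "int p dvd d" using not_dvd_imp_multiplicity_0[of "int p" d] by argo
    then have "int p dvd n * b" unfolding eq by (rule dvd_mult)
    then have "int p dvd n" using ab(2) prime_int_p by (simp add: prime_dvd_mult_iff)
    then show False using coprime_common_divisor[OF cop _ \<open>int p dvd d\<close>] unit by blast
  qed
  ultimately show ?thesis by (simp add: rat_cong_def padic_val_def nd)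
qed (simp add: rat_cong_def)

section \<open>Harmonic sums over the even residues\<close>

abbreviation H :: "nat \<Rightarrow> rat" where "H s \<equiv> gen_harm s (p - 1)"

abbreviation evens :: "nat set" where "evens \<equiv> {k \<in> {1..p - 1}. even k}"

lemma sum_reflect: "(\<Sum>k=1..p - 1. f (p - k)) = (\<Sum>k=1..p - 1. f k)"
  by (rule sum.reindex_bij_witness[of _ "\<lambda>k. p - k" "\<lambda>k. p - k"]) auto

text \<open>As p is odd, k -> p - k exchanges even and odd residues.\<close>

lemma sum_split_evens:
  fixes f :: "nat \<Rightarrow> rat"
  shows "(\<Sum>k=1..p - 1. f k) = (\<Sum>k\<in>evens. f k + f (p - k))"
proof -
  have split: "{1..p - 1} = evens \<union> {k \<in> {1..p - 1}. odd k}" by auto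
  have "(\<Sum>k=1..p - 1. f k) = sum f evens + sum f {k \<in> {1..p - 1}. odd k}"
    by (subst split, rule sum.union_disjoint) auto
  also have "sum f {k \<in> {1..p - 1}. odd k} = (\<Sum>k\<in>evens. f (p - k))"
    by (rule sum.reindex_bij_witness[of _ "\<lambda>k. p - k" "\<lambda>k. p - k"]) (use odd_p in auto)
  finally show ?thesis by (simp add: sum.distrib)
qed

text \<open>An even number below 2p is either an even number below p or 2p minus one. Together with
  \<open>sum_split_evens\<close> this gives two evaluations in terms of the same sums over
  \<open>evens\<close>.\<close>

lemma sum_double_split_evens:
  fixes f :: "nat \<Rightarrow> rat"
  shows "(\<Sum>k=1..p - 1. f (2 * k)) = (\<Sum>k\<in>evens. f k + f (2 * p - k))"
proof -
  let ?A = "{k \<in> {1..p - 1}. 2 * k < p}" and ?B = "{k \<in> {1..p - 1}. \<not> 2 * k < p}"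
  have "(\<Sum>k=1..p - 1. f (2 * k)) = (\<Sum>k\<in>?A \<union> ?B. f (2 * k))"
    by (rule sum.cong) auto
  also have "\<dots> = (\<Sum>k\<in>?A. f (2 * k)) + (\<Sum>k\<in>?B. f (2 * k))"
    by (rule sum.union_disjoint) auto
  also have "(\<Sum>k\<in>?A. f (2 * k)) = (\<Sum>k\<in>evens. f k)"
    by (rule sum.reindex_bij_witness[of _ "\<lambda>k. k div 2" "\<lambda>k. 2 * k"]) auto
  also have "(\<Sum>k\<in>?B. f (2 * k)) = (\<Sum>k\<in>evens. f (2 * p - k))"
  proof (rule sum.reindex_bij_witness[of _ "\<lambda>k. p - k div 2" "\<lambda>k. 2 * p - 2 * k"])
    fix k assume k: "k \<in> ?B"
    then have "p < 2 * k" using odd_p by (metis (mono_tags, lifting) dvd_triv_left mem_Collect_eq nat_neq_iff)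
    then show "2 * p - 2 * k \<in> evens" using k by auto
    show "p - (2 * p - 2 * k) div 2 = k" using k by auto
    show "f (2 * p - (2 * p - 2 * k)) = f (2 * k)" using k by auto
  next
    fix k assume k: "k \<in> evens"
    then obtain j where j: "k = 2 * j" by (auto elim: evenE)
    show "p - k div 2 \<in> ?B" "2 * p - 2 * (p - k div 2) = k" using k by (auto simp: j)
  qed
  finally show ?thesis by (simp add: sum.distrib)
qed

text \<open>The constant denominators in the congruences have only the prime factors 2, 3 and 5, so
  p > 5 keeps them invertible.\<close>

lemma not_dvd_smooth: "\<not> p dvd 2 ^ a * 3 ^ b * 5 ^ c"
proof
  assume "p dvd 2 ^ a * 3 ^ b * 5 ^ c"
  then have "p dvd 2 \<or> p dvd 3 \<or> p dvd 5"
    using prime_p by (metis prime_dvd_mult_iff prime_dvd_power)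
  then have "p \<le> 5" by (auto dest!: dvd_imp_le)
  then show False using p_gt_5 by simp
qed

lemma Zp_divide_smooth: "x \<in> Zp \<Longrightarrow> x / (2 ^ a * 3 ^ b * 5 ^ c) \<in> Zp"
  using Zp_divide_nat[OF _ not_dvd_smooth, of x a b c] by simp

lemma Zp_divide_numerals [simp]:
  assumes "x \<in> Zp"
  shows "x / 4 \<in> Zp" "x / 6 \<in> Zp" "x / 8 \<in> Zp" "x / 9 \<in> Zp" "x / 15 \<in> Zp" "x / 16 \<in> Zp"
    "x / 32 \<in> Zp" "x / 64 \<in> Zp" "x / 48 \<in> Zp"
  using Zp_divide_smooth[OF assms, of 2 0 0] Zp_divide_smooth[OF assms, of 1 1 0]
    Zp_divide_smooth[OF assms, of 3 0 0] Zp_divide_smooth[OF assms, of 0 2 0]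
    Zp_divide_smooth[OF assms, of 0 1 1] Zp_divide_smooth[OF assms, of 4 0 0]
    Zp_divide_smooth[OF assms, of 5 0 0] Zp_divide_smooth[OF assms, of 6 0 0]
    Zp_divide_smooth[OF assms, of 4 1 0]
  by simp_all

abbreviation inv_nat :: "nat \<Rightarrow> rat" where "inv_nat k \<equiv> 1 / of_nat k"

lemma H_eq_sum: "H s = (\<Sum>k=1..p - 1. inv_nat k ^ s)"
  by (simp add: gen_harm_def power_one_over)

definition E :: "nat \<Rightarrow> rat" where "E s = (\<Sum>k\<in>evens. inv_nat k ^ s)"

lemma Zp_H [simp]: "H s \<in> Zp" unfolding H_eq_sum by (intro Zp_sum Zp_power Zp_inverse) auto
lemma Zp_E [simp]: "E s \<in> Zp" unfolding E_def by (intro Zp_sum Zp_power Zp_inverse) auto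

lemma Zp_inv_nat: "k \<in> {1..p - 1} \<Longrightarrow> inv_nat k \<in> Zp"
  by (intro Zp_inverse) auto

lemma inv_nat_shift:
  assumes "k \<in> {1..p - 1}" "c > 0"
  shows "inv_nat (c * p - k) \<in> Zp"
    "inv_nat k = inv_nat (c * p - k) * (of_nat c * P * inv_nat k - 1)"
proof -
  have k: "0 < k" "k < p" "k < c * p"
    using assms less_le_trans[of k p "c * p"] by auto
  have e: "of_nat (c * p - k) = (of_nat c * P - of_nat k :: rat)" using k by (simp add: of_nat_diff)
  show "inv_nat (c * p - k) \<in> Zp" unfolding e using Zp_inverse_shift[OF k(1,2), of "int c"] by simp
  have ne: "of_nat (c * p - k) \<noteq> (0 :: rat)" using k(3) unfolding of_nat_eq_0_iff by linarith
  have "of_nat c * P * inv_nat k - 1 = of_nat (c * p - k) / of_nat k"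
    unfolding e using k(1) by (simp add: diff_divide_distrib)
  moreover have "1 / a = 1 / d * (d / a)" if "d \<noteq> 0" for a d :: rat
    using that by simp
  ultimately show "inv_nat k = inv_nat (c * p - k) * (of_nat c * P * inv_nat k - 1)"
    using ne by metis
qed

text \<open>Truncated binomial series of v = -u / (1 - x). The remainders are exact and polynomial
  in x and v, so their p-integrality is visible when x is a multiple of p.\<close>

lemma recip_expansion:
  fixes u v x :: rat
  assumes "u = v * (x - 1)"
  shows "u + v = - u * (x + x ^ 2 + x ^ 3 + x ^ 4) + x ^ 5 * v"
    "v ^ 2 = u ^ 2 * (1 + 2 * x + 3 * x ^ 2 + 4 * x ^ 3) + x ^ 4 * ((5 - 4 * x) * v ^ 2)"
    "u ^ 3 + v ^ 3 = - (u ^ 3) * (3 * x + 6 * x ^ 2) + x ^ 3 * ((10 - 15 * x + 6 * x ^ 2) * v ^ 3)"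
    "v ^ 4 = u ^ 4 * (1 + 4 * x) + x ^ 2 * ((10 - 20 * x + 15 * x ^ 2 - 4 * x ^ 3) * v ^ 4)"
    "v = - u + x * v"
  unfolding assms by (simp_all add: algebra_simps power_numeral_reduce)

lemma sum_evens_4:
  assumes "c > 0"
  shows "pcong 2 (\<Sum>k\<in>evens. inv_nat k ^ 4 + inv_nat (c * p - k) ^ 4) (2 * E 4 + 4 * of_nat c * P * E 5)"
proof -
  have "pcong 2 (inv_nat k ^ 4 + inv_nat (c * p - k) ^ 4) (2 * inv_nat k ^ 4 + 4 * of_nat c * P * inv_nat k ^ 5)"
    if "k \<in> evens" for k
  proof -
    define u v where "u = inv_nat k" and "v = inv_nat (c * p - k)"
    have uv: "u \<in> Zp" "v \<in> Zp" "u = v * (of_nat c * P * u - 1)"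
      unfolding u_def v_def using that assms by (blast intro: Zp_inv_nat inv_nat_shift)+
    have "u ^ 4 + v ^ 4 = 2 * u ^ 4 + 4 * of_nat c * P * u ^ 5 + P ^ 2 * ((of_nat c * u) ^ 2 *
       ((10 - 20 * (of_nat c * P * u) + 15 * (of_nat c * P * u) ^ 2 - 4 * (of_nat c * P * u) ^ 3) * v ^ 4))"
      using recip_expansion(4)[OF uv(3)] by (simp add: algebra_simps power_numeral_reduce)
    then show ?thesis unfolding u_def[symmetric] v_def[symmetric] by (rule pcongI) (use uv(1,2) in simp)
  qed
  then have "pcong 2 (\<Sum>k\<in>evens. inv_nat k ^ 4 + inv_nat (c * p - k) ^ 4)
      (\<Sum>k\<in>evens. 2 * inv_nat k ^ 4 + 4 * of_nat c * P * inv_nat k ^ 5)"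
    by (rule pcong_sum)
  then show ?thesis by (simp add: E_def sum.distrib sum_distrib_left)
qed

lemma sum_evens_2:
  assumes "c > 0"
  shows "pcong 4 (\<Sum>k\<in>evens. inv_nat k ^ 2 + inv_nat (c * p - k) ^ 2)
    (2 * E 2 + 2 * of_nat c * P * E 3 + 3 * of_nat c ^ 2 * P ^ 2 * E 4 + 4 * of_nat c ^ 3 * P ^ 3 * E 5)"
proof -
  have "pcong 4 (inv_nat k ^ 2 + inv_nat (c * p - k) ^ 2)
      (2 * inv_nat k ^ 2 + 2 * of_nat c * P * inv_nat k ^ 3 + 3 * of_nat c ^ 2 * P ^ 2 * inv_nat k ^ 4
       + 4 * of_nat c ^ 3 * P ^ 3 * inv_nat k ^ 5)"
    if "k \<in> evens" for k
  proof -
    define u v where "u = inv_nat k" and "v = inv_nat (c * p - k)"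
    have uv: "u \<in> Zp" "v \<in> Zp" "u = v * (of_nat c * P * u - 1)"
      unfolding u_def v_def using that assms by (blast intro: Zp_inv_nat inv_nat_shift)+
    have "u ^ 2 + v ^ 2 = 2 * u ^ 2 + 2 * of_nat c * P * u ^ 3 + 3 * of_nat c ^ 2 * P ^ 2 * u ^ 4
       + 4 * of_nat c ^ 3 * P ^ 3 * u ^ 5 + P ^ 4 * ((of_nat c * u) ^ 4 * ((5 - 4 * (of_nat c * P * u)) * v ^ 2))"
      using recip_expansion(2)[OF uv(3)] by (simp add: algebra_simps power_numeral_reduce)
    then show ?thesis unfolding u_def[symmetric] v_def[symmetric] by (rule pcongI) (use uv(1,2) in simp)
  qed
  then have "pcong 4 (\<Sum>k\<in>evens. inv_nat k ^ 2 + inv_nat (c * p - k) ^ 2)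
      (\<Sum>k\<in>evens. 2 * inv_nat k ^ 2 + 2 * of_nat c * P * inv_nat k ^ 3 + 3 * of_nat c ^ 2 * P ^ 2 * inv_nat k ^ 4
       + 4 * of_nat c ^ 3 * P ^ 3 * inv_nat k ^ 5)"
    by (rule pcong_sum)
  then show ?thesis by (simp add: E_def sum.distrib sum_distrib_left)
qed

lemma H_evens: "H s = (\<Sum>k\<in>evens. inv_nat k ^ s + inv_nat (1 * p - k) ^ s)"
  unfolding H_eq_sum by (subst sum_split_evens) simp

lemma H_double_evens: "H s / 2 ^ s = (\<Sum>k\<in>evens. inv_nat k ^ s + inv_nat (2 * p - k) ^ s)"
proof -
  have "H s / 2 ^ s = (\<Sum>k=1..p - 1. inv_nat (2 * k) ^ s)"
    unfolding H_eq_sum sum_divide_distrib by (simp add: power_divide power_mult_distrib mult.commute)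
  also have "\<dots> = (\<Sum>k\<in>evens. inv_nat k ^ s + inv_nat (2 * p - k) ^ s)"
    by (rule sum_double_split_evens)
  finally show ?thesis .
qed

text \<open>\<open>sum_evens_4\<close> with c = 1 and c = 2 evaluates \<open>H 4\<close> and
  \<open>H 4 / 16\<close>: two linear equations for \<open>E 4\<close> and \<open>P * E 5\<close>.
  The first solution also shows that p divides \<open>H 4\<close>.\<close>

lemma E5_cong: "pcong 2 (P * E 5) (- 15 / 64 * H 4)"
  and E4_cong: "pcong 2 (E 4) (31 / 32 * H 4)"
  and H4_cong_0: "pcong 1 (H 4) 0"
proof -
  obtain x where x: "x \<in> Zp" "H 4 = 2 * E 4 + 4 * P * E 5 + P ^ 2 * x"
    using sum_evens_4[of 1] unfolding H_evens[symmetric] by (auto elim: pcongE)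
  obtain y where y: "y \<in> Zp" "H 4 / 16 = 2 * E 4 + 8 * P * E 5 + P ^ 2 * y"
    using sum_evens_4[of 2] unfolding H_double_evens[symmetric] by (auto elim: pcongE)
  have "P * E 5 = - 15 / 64 * H 4 + P ^ 2 * (x / 4 - y / 4)" using x(2) y(2) by (simp add: field_simps)
  then show "pcong 2 (P * E 5) (- 15 / 64 * H 4)" by (rule pcongI) (use x(1) y(1) in simp)
  have "E 4 = 31 / 32 * H 4 + P ^ 2 * (y / 2 - x)" using x(2) y(2) by (simp add: field_simps)
  then show "pcong 2 (E 4) (31 / 32 * H 4)" by (rule pcongI) (use x(1) y(1) in simp)
  have "H 4 = 0 + P ^ 1 * (- (64 / 15) * E 5 + 16 / 15 * (P * (x - y)))"
    using x(2) y(2) by (simp add: field_simps power2_eq_square)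
  then show "pcong 1 (H 4) 0" by (rule pcongI) (use x(1) y(1) in simp)
qed

text \<open>\<open>sum_evens_2\<close> with c = 1 and c = 2 expands \<open>H 2\<close> and
  \<open>H 2 / 4\<close>; their difference is divisible by p. The alternating sum is
  \<open>H 2 - 2 * E 2\<close>.\<close>

lemma H2_cong_0: "pcong 1 (H 2) 0"
  and alternating_sum_cong:
    "pcong 4 (\<Sum>k=1..p - 1. (-1) ^ (k - 1) / of_nat k ^ 2) (- 3 / 4 * H 2 - 3 / 16 * P ^ 2 * H 4)"
proof -
  obtain x where x: "x \<in> Zp" "H 2 = 2 * E 2 + 2 * P * E 3 + 3 * P ^ 2 * E 4 + 4 * P ^ 3 * E 5 + P ^ 4 * x"
    using sum_evens_2[of 1] unfolding H_evens[symmetric] by (auto elim: pcongE)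
  obtain y where y: "y \<in> Zp" "H 2 / 4 = 2 * E 2 + 4 * P * E 3 + 12 * P ^ 2 * E 4 + 32 * P ^ 3 * E 5 + P ^ 4 * y"
    using sum_evens_2[of 2] unfolding H_double_evens[symmetric] by (auto elim: pcongE)
  have "H 2 = 4 / 3 * (H 2 - H 2 / 4)" by simp
  also have "\<dots> = 0 + P ^ 1 * (4 / 3 * (- 2 * E 3 - 9 * P * E 4 - 28 * P ^ 2 * E 5 + P ^ 3 * (x - y)))"
    by (subst y(2), subst x(2)) (simp add: algebra_simps power_numeral_reduce)
  finally show "pcong 1 (H 2) 0" by (rule pcongI) (use x(1) y(1) in simp)
  obtain z where z: "z \<in> Zp" "P * E 5 = - 15 / 64 * H 4 + P ^ 2 * z" using E5_cong by (elim pcongE)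
  obtain w where w: "w \<in> Zp" "E 4 = 31 / 32 * H 4 + P ^ 2 * w" using E4_cong by (elim pcongE)
  have "(\<Sum>k=1..p - 1. (-1) ^ (k - 1) / of_nat k ^ 2) = H 2 - 2 * E 2"
  proof -
    have "(\<Sum>k=1..p - 1. (-1) ^ (k - 1) / of_nat k ^ 2)
        = (\<Sum>k=1..p - 1. inv_nat k ^ 2 - (if even k then 2 * inv_nat k ^ 2 else 0))"
      by (rule sum.cong) (auto simp: power_one_over)
    also have "\<dots> = H 2 - (\<Sum>k=1..p - 1. if even k then 2 * inv_nat k ^ 2 else 0)"
      by (simp only: sum_subtractf H_eq_sum)
    also have "(\<Sum>k=1..p - 1. if even k then 2 * inv_nat k ^ 2 else 0) = 2 * E 2"
      unfolding E_def sum_distrib_left by (rule sum.inter_filter[symmetric]) simp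
    finally show ?thesis .
  qed
  also have "\<dots> = - 3 / 4 * H 2 - 6 * P ^ 2 * E 4 - 24 * P ^ 2 * (P * E 5) + P ^ 4 * (2 * x - y)"
  proof -
    \<comment> \<open>The combination is chosen so that \<open>E 2\<close> and \<open>E 3\<close>
      both cancel; \<open>E 4\<close> and \<open>E 5\<close> are known from \<open>E4_cong\<close>
      and \<open>E5_cong\<close>.\<close>
    have "H 2 - 2 * E 2 = - 3 / 4 * H 2 + (2 * H 2 - H 2 / 4 - 2 * E 2)" by simp
    also have "2 * H 2 - H 2 / 4 - 2 * E 2 = - 6 * P ^ 2 * E 4 - 24 * P ^ 2 * (P * E 5) + P ^ 4 * (2 * x - y)"
      by (subst y(2), subst x(2)) (simp add: algebra_simps power_numeral_reduce)
    finally show ?thesis by simp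
  qed
  also have "\<dots> = - 3 / 4 * H 2 - 3 / 16 * P ^ 2 * H 4 + P ^ 4 * (2 * x - y - 6 * w - 24 * z)"
    unfolding z(2) w(2) by (simp add: algebra_simps power_numeral_reduce)
  finally show "pcong 4 (\<Sum>k=1..p - 1. (-1) ^ (k - 1) / of_nat k ^ 2) (- 3 / 4 * H 2 - 3 / 16 * P ^ 2 * H 4)"
    by (rule pcongI) (use x(1) y(1) z(1) w(1) in simp)
qed

section \<open>Reflection k -> p - k and the sums \<open>H 1\<close>, \<open>H 3\<close>,
  \<open>H 5\<close>\<close>

lemma H_reflect: "(\<Sum>k=1..p - 1. inv_nat (1 * p - k) ^ s) = H s"
  unfolding H_eq_sum using sum_reflect[of "\<lambda>k. inv_nat k ^ s"] by simp

lemma inv_nat_reflect_cong: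
  assumes "k \<in> {1..p - 1}"
  shows "pcong 1 (inv_nat (1 * p - k)) (- inv_nat k)"
proof -
  have uv: "inv_nat k \<in> Zp" "inv_nat (1 * p - k) \<in> Zp" "inv_nat k = inv_nat (1 * p - k) * (of_nat 1 * P * inv_nat k - 1)"
    using assms by (blast intro: Zp_inv_nat inv_nat_shift zero_less_one)+
  then show ?thesis
    using recip_expansion(5)[OF uv(3)] by (intro pcongI[of _ _ _ "inv_nat k * inv_nat (1 * p - k)"]) (simp only: of_nat_1 power_one_right mult_1 mult.assoc, rule Zp_mult)
qed

lemma H5_cong_0: "pcong 1 (H 5) 0"
proof -
  have "pcong 1 (inv_nat (1 * p - k) ^ 5) (- (inv_nat k ^ 5))" if "k \<in> {1..p - 1}" for k
    using pcong_power[OF inv_nat_reflect_cong[OF that], of 5] Zp_inv_nat[OF that] by simp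
  then have "pcong 1 (\<Sum>k=1..p - 1. inv_nat (1 * p - k) ^ 5) (\<Sum>k=1..p - 1. - (inv_nat k ^ 5))"
    by (rule pcong_sum)
  then have "pcong 1 (H 5) (- H 5)" unfolding H_reflect by (simp only: sum_negf H_eq_sum)
  then obtain z where "z \<in> Zp" "H 5 = - H 5 + P ^ 1 * z" by (elim pcongE)
  then show ?thesis by (intro pcongI[of _ _ _ "z / 2"]) auto
qed

text \<open>Adding the terms at k and p - k expresses \<open>2 * H 3\<close> through
  \<open>H 4\<close> and \<open>H 5\<close>; the latter is divisible by p.\<close>

lemma H3_cong: "pcong 3 (H 3) (- 3 / 2 * P * H 4)"
proof -
  have "pcong 3 (inv_nat k ^ 3 + inv_nat (1 * p - k) ^ 3) (- 3 * P * inv_nat k ^ 4 - 6 * P ^ 2 * inv_nat k ^ 5)"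
    if "k \<in> {1..p - 1}" for k
  proof -
    define u v where "u = inv_nat k" and "v = inv_nat (1 * p - k)"
    have uv: "u \<in> Zp" "v \<in> Zp" "u = v * (of_nat 1 * P * u - 1)"
      unfolding u_def v_def using that by (blast intro: Zp_inv_nat inv_nat_shift zero_less_one)+
    have "u ^ 3 + v ^ 3 = - 3 * P * u ^ 4 - 6 * P ^ 2 * u ^ 5
        + P ^ 3 * (u ^ 3 * ((10 - 15 * (P * u) + 6 * (P * u) ^ 2) * v ^ 3))"
      using recip_expansion(3)[OF uv(3)] by (simp add: algebra_simps power_numeral_reduce)
    then show ?thesis unfolding u_def[symmetric] v_def[symmetric] by (rule pcongI) (use uv(1,2) in simp)
  qed
  then have "pcong 3 (\<Sum>k=1..p - 1. inv_nat k ^ 3 + inv_nat (1 * p - k) ^ 3)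
      (\<Sum>k=1..p - 1. - 3 * P * inv_nat k ^ 4 - 6 * P ^ 2 * inv_nat k ^ 5)"
    by (rule pcong_sum)
  then have "pcong 3 (H 3 + H 3) (- 3 * P * H 4 - 6 * P ^ 2 * H 5)"
    by (simp only: sum.distrib sum_subtractf sum_negf H_reflect H_eq_sum[symmetric] sum_distrib_left[symmetric])
  then obtain z where z: "z \<in> Zp" "H 3 + H 3 = - 3 * P * H 4 - 6 * P ^ 2 * H 5 + P ^ 3 * z"
    by (elim pcongE)
  obtain w where w: "w \<in> Zp" "H 5 = 0 + P ^ 1 * w" using H5_cong_0 by (elim pcongE)
  have "H 3 = - 3 / 2 * P * H 4 + P ^ 3 * (z / 2 - 3 * w)"
    using z(2) w(2) by (simp add: field_simps power_numeral_reduce)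
  then show ?thesis by (rule pcongI) (use z(1) w(1) in simp)
qed

text \<open>Pairing k with p - k again, with \<open>H 3\<close> replaced by \<open>H3_cong\<close>.
  Solving for \<open>P * H 2\<close> prepares its elimination in favour of
  \<open>H 1\<close>.\<close>

lemma H1_cong: "pcong 5 (P * H 2) (- 2 * H 1 + P ^ 3 * H 4 / 2)"
proof -
  have "pcong 5 (inv_nat k ^ 1 + inv_nat (1 * p - k) ^ 1)
      (- (P * inv_nat k ^ 2) - P ^ 2 * inv_nat k ^ 3 - P ^ 3 * inv_nat k ^ 4 - P ^ 4 * inv_nat k ^ 5)"
    if "k \<in> {1..p - 1}" for k
  proof -
    define u v where "u = inv_nat k" and "v = inv_nat (1 * p - k)"
    have uv: "u \<in> Zp" "v \<in> Zp" "u = v * (of_nat 1 * P * u - 1)"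
      unfolding u_def v_def using that by (blast intro: Zp_inv_nat inv_nat_shift zero_less_one)+
    have "u ^ 1 + v ^ 1 = - (P * u ^ 2) - P ^ 2 * u ^ 3 - P ^ 3 * u ^ 4 - P ^ 4 * u ^ 5 + P ^ 5 * (u ^ 5 * v)"
      using recip_expansion(1)[OF uv(3)] by (simp add: algebra_simps power_numeral_reduce)
    then show ?thesis unfolding u_def[symmetric] v_def[symmetric] by (rule pcongI) (use uv(1,2) in simp)
  qed
  then have "pcong 5 (\<Sum>k=1..p - 1. inv_nat k ^ 1 + inv_nat (1 * p - k) ^ 1)
      (\<Sum>k=1..p - 1. - (P * inv_nat k ^ 2) - P ^ 2 * inv_nat k ^ 3 - P ^ 3 * inv_nat k ^ 4 - P ^ 4 * inv_nat k ^ 5)"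
    by (rule pcong_sum)
  then have "pcong 5 (H 1 + H 1) (- (P * H 2) - P ^ 2 * H 3 - P ^ 3 * H 4 - P ^ 4 * H 5)"
    by (simp only: sum.distrib sum_subtractf sum_negf H_reflect H_eq_sum[symmetric] sum_distrib_left[symmetric])
  then obtain z where z: "z \<in> Zp" "H 1 + H 1 = - (P * H 2) - P ^ 2 * H 3 - P ^ 3 * H 4 - P ^ 4 * H 5 + P ^ 5 * z"
    by (elim pcongE)
  obtain w where w: "w \<in> Zp" "H 5 = 0 + P ^ 1 * w" using H5_cong_0 by (elim pcongE)
  obtain y where y: "y \<in> Zp" "H 3 = - 3 / 2 * P * H 4 + P ^ 3 * y" using H3_cong by (elim pcongE)
  have "P * H 2 = - 2 * H 1 + P ^ 3 * H 4 / 2 + P ^ 5 * (z - w - y)"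
    using z(2) unfolding w(2) y(2) by (simp add: field_simps power_numeral_reduce)
  then show ?thesis by (rule pcongI) (use z(1) w(1) y(1) in simp)
qed

section \<open>The sum of \<open>1 / (k\<^sup>2 (2k choose k))\<close>\<close>

lemma Zp_gen_harm: "k < p \<Longrightarrow> gen_harm s k \<in> Zp"
  unfolding gen_harm_def by (intro Zp_sum, subst power_one_over[symmetric], intro Zp_power Zp_inverse) auto

lemma Zp_elem_harm_2: "k < p \<Longrightarrow> elem_harm_2 k \<in> Zp"
  unfolding elem_harm_2_def by (intro Zp_half Zp_diff Zp_power Zp_gen_harm)

lemma Zp_hom_harm_2: "k < p \<Longrightarrow> hom_harm_2 k \<in> Zp"
  unfolding hom_harm_2_def by (intro Zp_half Zp_add Zp_power Zp_gen_harm)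

definition X :: "nat \<Rightarrow> rat" where "X k = (\<Prod>i=1..k. 1 - P ^ 2 / of_nat i ^ 2)"

lemma X_Suc: "X (Suc k) = X k * (1 - P ^ 2 * (1 / of_nat (Suc k) ^ 2))"
  by (simp add: X_def)

lemma X_cong:
  assumes "k < p"
  shows "pcong 6 (X k) (1 - P ^ 2 * gen_harm 2 k + P ^ 4 * elem_harm_2 k)"
  using assms
proof (induction k)
  case 0
  show ?case by (simp add: X_def elem_harm_2_def)
next
  case (Suc k)
  define q e w where "q = gen_harm 2 k" and "e = elem_harm_2 k" and "w = 1 / (of_nat (Suc k) :: rat) ^ 2"
  have Zp: "q \<in> Zp" "e \<in> Zp" "w \<in> Zp"
    unfolding q_def e_def w_def power_one_over[symmetric]
    using Suc.prems Zp_inverse[of "Suc k"] by (auto intro!: Zp_gen_harm Zp_elem_harm_2 simp del: of_nat_Suc)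
  obtain z where z: "z \<in> Zp" "X k = 1 - P ^ 2 * q + P ^ 4 * e + P ^ 6 * z"
    using Suc unfolding q_def e_def by (auto elim: pcongE)
  have "X (Suc k) = 1 - P ^ 2 * (q + w) + P ^ 4 * (e + q * w) + P ^ 6 * (z - P ^ 2 * z * w - e * w)"
    unfolding X_Suc z(2) w_def[symmetric] by (simp add: algebra_simps power_numeral_reduce)
  moreover have "gen_harm 2 (Suc k) = q + w" "elem_harm_2 (Suc k) = e + q * w"
    by (simp_all add: gen_harm_Suc elem_harm_2_Suc q_def e_def w_def del: of_nat_Suc)
  ultimately show ?case using Zp z(1) by (auto intro!: pcongI)
qed

text \<open>Each factor is a p-adic unit, because p does not divide i^2 - p^2 for 0 < i < p.\<close>

lemma inverse_X:
  assumes "k < p"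
  shows "X k \<noteq> 0" "1 / X k \<in> Zp"
proof -
  have f: "1 - P ^ 2 / of_nat i ^ 2 \<noteq> 0 \<and> 1 / (1 - P ^ 2 / of_nat i ^ 2) \<in> Zp" if "i \<in> {1..k}" for i
  proof -
    have i: "0 < i" "i < p" using that assms by auto
    have nd: "\<not> int p dvd int i ^ 2 - int p ^ 2"
    proof
      assume "int p dvd int i ^ 2 - int p ^ 2"
      then have "int p dvd int i ^ 2" by (metis dvd_diff_left_iff dvd_power zero_less_numeral)
      then have "p dvd i" using prime_int_p prime_dvd_power int_dvd_int_iff by blast
      then show False using i by (auto dest: dvd_imp_le)
    qed
    then have ne: "int i ^ 2 - int p ^ 2 \<noteq> 0" by auto
    have eq: "1 - P ^ 2 / of_nat i ^ 2 = of_int (int i ^ 2 - int p ^ 2) / of_nat i ^ 2"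
      using i by (simp add: diff_divide_distrib)
    have "1 / (1 - P ^ 2 / of_nat i ^ 2) = of_nat i ^ 2 / of_int (int i ^ 2 - int p ^ 2)"
      unfolding eq by simp
    also have "\<dots> \<in> Zp" using nd by (intro Zp_divide_int Zp_power Zp_of_nat)
    finally show ?thesis using ne i unfolding eq by (simp del: of_int_diff)
  qed
  then show "X k \<noteq> 0" by (simp add: X_def)
  have "1 / X k = (\<Prod>i=1..k. 1 / (1 - P ^ 2 / of_nat i ^ 2))"
    by (simp add: X_def prod_dividef)
  then show "1 / X k \<in> Zp" using f by (simp only:) (intro Zp_prod, blast)
qed

text \<open>With h = q^2 - e, the product of the truncated series for \<open>X k\<close> and
  \<open>1 / X k\<close> is 1 up to p^6.\<close>

lemma inverse_X_cong:
  assumes "k < p"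
  shows "pcong 6 (1 / X k) (1 + P ^ 2 * gen_harm 2 k + P ^ 4 * hom_harm_2 k)"
proof -
  define q e h where "q = gen_harm 2 k" and "e = elem_harm_2 k" and "h = hom_harm_2 k"
  have Zp: "q \<in> Zp" "e \<in> Zp" "h \<in> Zp"
    unfolding q_def e_def h_def using assms by (auto intro!: Zp_gen_harm Zp_elem_harm_2 Zp_hom_harm_2)
  have he: "h = q ^ 2 - e" by (simp add: h_def e_def q_def hom_harm_2_def elem_harm_2_def field_simps)
  obtain z where z: "z \<in> Zp" "X k = 1 - P ^ 2 * q + P ^ 4 * e + P ^ 6 * z"
    using X_cong[OF assms] unfolding q_def e_def by (auto elim: pcongE)
  define y where "y = z + q * (e - h) + P ^ 2 * (z * q + e * h) + P ^ 4 * z * h"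
  have "X k * (1 + P ^ 2 * q + P ^ 4 * h) = 1 + P ^ 6 * y"
    unfolding z(2) he y_def by (simp add: algebra_simps power_numeral_reduce)
  then have "1 / X k = 1 + P ^ 2 * q + P ^ 4 * h + P ^ 6 * (- y * (1 / X k))"
    using inverse_X(1)[OF assms] by (simp add: field_simps)
  moreover have "- y * (1 / X k) \<in> Zp"
    using inverse_X(2)[OF assms] Zp z(1) unfolding y_def by (intro Zp_mult Zp_uminus) simp_all
  ultimately show ?thesis unfolding q_def[symmetric] h_def[symmetric] by (rule pcongI)
qed

lemma gen_harm_2_reflect_cong:
  "m < p \<Longrightarrow> pcong 1 (gen_harm 2 (p - 1 - m)) (- gen_harm 2 m)"
proof (induction m)
  case 0
  show ?case using H2_cong_0 by simp
next
  case (Suc m)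
  then have m: "Suc m \<in> {1..p - 1}" and IH: "pcong 1 (gen_harm 2 (p - 1 - m)) (- gen_harm 2 m)" by auto
  have e: "p - 1 - m = Suc (p - 1 - Suc m)" "Suc (p - 1 - Suc m) = 1 * p - Suc m" using Suc.prems by auto
  have "pcong 1 (inv_nat (1 * p - Suc m) ^ 2) ((- inv_nat (Suc m)) ^ 2)"
    by (intro pcong_power inv_nat_reflect_cong m Zp_uminus Zp_inv_nat)
  from pcong_diff[OF IH this]
  show ?case unfolding e(1) gen_harm_Suc unfolding e(2)
    by (simp add: power_one_over gen_harm_Suc power_divide del: of_nat_Suc)
qed

text \<open>Modulo p, the reflection k -> p - k exchanges the two harmonic factors up to sign and
  negates 1/k, so the sum equals its own negative.\<close>

lemma sum_gen_harm_2_product_cong_0: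
  "pcong 1 (\<Sum>k=1..p - 1. gen_harm 2 (k - 1) * gen_harm 2 k * inv_nat k) 0"
proof -
  let ?f = "\<lambda>k. gen_harm 2 (k - 1) * gen_harm 2 k * inv_nat k"
  have "pcong 1 (?f (p - k)) (- ?f k)" if k: "k \<in> {1..p - 1}" for k
  proof -
    have e: "p - k - 1 = p - 1 - k" "p - k = p - 1 - (k - 1)" "k < p" "k - 1 < p" using k by auto
    have Zp: "gen_harm 2 k \<in> Zp" "gen_harm 2 (k - 1) \<in> Zp" "gen_harm 2 (p - k) \<in> Zp" "inv_nat (p - k) \<in> Zp"
      using k by (auto intro!: Zp_gen_harm Zp_inverse)
    have 1: "pcong 1 (gen_harm 2 (p - k - 1)) (- gen_harm 2 k)"
      unfolding e(1) by (rule gen_harm_2_reflect_cong[OF e(3)])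
    have 2: "pcong 1 (gen_harm 2 (p - k)) (- gen_harm 2 (k - 1))"
      unfolding e(2) by (rule gen_harm_2_reflect_cong[OF e(4)])
    have 3: "pcong 1 (inv_nat (p - k)) (- inv_nat k)" using inv_nat_reflect_cong[OF k] by simp
    have "pcong 1 (gen_harm 2 (p - k - 1) * gen_harm 2 (p - k) * inv_nat (p - k))
      (- gen_harm 2 k * - gen_harm 2 (k - 1) * - inv_nat k)"
      by (intro pcong_mult 1 2 3 Zp_mult Zp_uminus Zp)
    then show ?thesis by (simp add: mult_ac)
  qed
  then have "pcong 1 (\<Sum>k=1..p - 1. ?f (p - k)) (\<Sum>k=1..p - 1. - ?f k)" by (rule pcong_sum)
  then have "pcong 1 (\<Sum>k=1..p - 1. ?f k) (- (\<Sum>k=1..p - 1. ?f k))"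
    unfolding sum_reflect[of ?f] sum_negf .
  then obtain z where "z \<in> Zp" "(\<Sum>k=1..p - 1. ?f k) = - (\<Sum>k=1..p - 1. ?f k) + P ^ 1 * z" by (elim pcongE)
  then show ?thesis by (intro pcongI[of _ _ _ "z / 2"]) auto
qed

definition H23 :: rat where "H23 = (\<Sum>k=1..p - 1. gen_harm 2 (k - 1) * inv_nat k ^ 3)"

lemma Zp_H23 [simp]: "H23 \<in> Zp"
  unfolding H23_def by (intro Zp_sum Zp_mult Zp_power Zp_gen_harm Zp_inv_nat) auto

text \<open>The subtraction of \<open>u * X k\<close> is what removes the double sum: at order p^2
  the terms -q u and r u combine to u^3. At order p^4, e + h = q r produces the product treated in
  \<open>sum_gen_harm_2_product_cong_0\<close>.\<close>

lemma sum_inverse_X_term_cong: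
  assumes k: "k \<in> {1..p - 1}"
  defines "u \<equiv> inv_nat k" and "v \<equiv> inv_nat (1 * p - k)" and "q \<equiv> gen_harm 2 (k - 1)" and "r \<equiv> gen_harm 2 k"
  shows "pcong 5 (v * (1 / X (k - 1)) - u * X k)
    (v - u + P ^ 2 * u ^ 3 - P ^ 3 * (q * u ^ 2) - P ^ 4 * (q * u ^ 3) - P ^ 4 * (q * r * u))"
proof -
  obtain j where j: "k = Suc j" using k by (cases k) auto
  have kp: "k < p" "k - 1 < p" using k by auto
  have uv: "u \<in> Zp" "v \<in> Zp" "u = v * (of_nat 1 * P * u - 1)"
    unfolding u_def v_def using k by (blast intro: Zp_inv_nat inv_nat_shift zero_less_one)+
  define e h where "e = elem_harm_2 k" and "h = hom_harm_2 (k - 1)"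
  have Zp: "q \<in> Zp" "r \<in> Zp" "e \<in> Zp" "h \<in> Zp"
    unfolding q_def r_def e_def h_def using k by (auto intro!: Zp_gen_harm Zp_elem_harm_2 Zp_hom_harm_2)
  have r: "r = q + u ^ 2" unfolding r_def q_def u_def by (simp add: j gen_harm_Suc power_one_over del: of_nat_Suc)
  have eh: "e + h = q * r"
  proof -
    have "elem_harm_2 (Suc j) + hom_harm_2 j = gen_harm 2 j ^ 2 + gen_harm 2 j / of_nat (Suc j) ^ 2"
      unfolding elem_harm_2_Suc by (simp add: elem_harm_2_def hom_harm_2_def field_simps del: of_nat_Suc)
    then show ?thesis unfolding e_def h_def r unfolding q_def u_def
      by (simp add: j power_one_over distrib_left power2_eq_square del: of_nat_Suc)
  qed
  obtain y where y: "y \<in> Zp" "X k = 1 - P ^ 2 * r + P ^ 4 * e + P ^ 6 * y"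
    using X_cong[OF kp(1)] unfolding r_def e_def by (auto elim: pcongE)
  obtain z where z: "z \<in> Zp" "1 / X (k - 1) = 1 + P ^ 2 * q + P ^ 4 * h + P ^ 6 * z"
    using inverse_X_cong[OF kp(2)] unfolding q_def h_def by (auto elim: pcongE)
  have v1: "v = - u + P * (u * v)" using recip_expansion(5)[OF uv(3)] by simp
  \<comment> \<open>Three iterations of \<open>v1\<close>: the term containing v3 carries p^2, and
    the modulus is p^5.\<close>
  have v3: "v = - u - P * u ^ 2 - P ^ 2 * u ^ 3 + P ^ 3 * (u ^ 3 * v)"
  proof -
    have "v = - u + P * (u * (- u + P * (u * (- u + P * (u * v)))))" using v1 by simp
    then show ?thesis by (simp add: algebra_simps power_numeral_reduce)
  qed
  have "v * (1 / X (k - 1)) = v + P ^ 2 * q * v + P ^ 4 * h * v + P ^ 6 * (v * z)"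
    unfolding z(2) by (simp add: algebra_simps)
  also have "P ^ 2 * q * v = P ^ 2 * q * (- u - P * u ^ 2 - P ^ 2 * u ^ 3 + P ^ 3 * (u ^ 3 * v))"
    using v3 by simp
  also have "P ^ 4 * h * v = P ^ 4 * h * (- u + P * (u * v))" using v1 by simp
  finally have "v * (1 / X (k - 1)) - u * X k
     = v - u + P ^ 2 * ((r - q) * u) - P ^ 3 * (q * u ^ 2) - P ^ 4 * (q * u ^ 3) - P ^ 4 * ((e + h) * u)
       + P ^ 5 * (q * u ^ 3 * v + h * u * v + P * (v * z) - P * (u * y))"
    unfolding y(2) by (simp add: algebra_simps power_numeral_reduce)
  also have "(r - q) * u = u ^ 3" by (simp add: r power_numeral_reduce)
  finally show ?thesis unfolding eh by (rule pcongI) (use uv(1,2) Zp y(1) z(1) in simp)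
qed

text \<open>Sum the termwise comparison and use the exact value -2 \<open>H 1\<close> of the
  subtracted sum. The coefficient of \<open>P ^ 3 * H 4\<close> is -3/2 from \<open>H 3\<close> plus
  1/2 from the sum of q u^2.\<close>

lemma sum_inverse_X_cong:
  "pcong 5 (\<Sum>k=1..p - 1. inv_nat (1 * p - k) * (1 / X (k - 1))) (- 2 * H 1 - P ^ 3 * H 4 - P ^ 4 * H23)"
proof -
  let ?W = "\<Sum>k=1..p - 1. inv_nat (1 * p - k) * (1 / X (k - 1))"
  define Q where "Q = (\<Sum>k=1..p - 1. gen_harm 2 (k - 1) * gen_harm 2 k * inv_nat k)"
  have "(\<Sum>k=1..p - 1. inv_nat k * X k) = - 2 * H 1"
    using sum_prod_div_eq_harm[OF odd_p] by (simp add: X_def)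
  moreover have "(\<Sum>k=1..p - 1. inv_nat (1 * p - k)) = H 1"
    using H_reflect[of 1] by simp
  moreover have "(\<Sum>k=1..p - 1. inv_nat k) = H 1" using H_eq_sum[of 1] by simp
  moreover have "(\<Sum>k=1..p - 1. gen_harm 2 (k - 1) * inv_nat k ^ 2) = (H 2 ^ 2 - H 4) / 2"
    using sum_gen_harm_2_div_square[of "p - 1"] by (simp add: power_one_over)
  moreover have "pcong 5 (\<Sum>k=1..p - 1. inv_nat (1 * p - k) * (1 / X (k - 1)) - inv_nat k * X k)
     (\<Sum>k=1..p - 1. inv_nat (1 * p - k) - inv_nat k + P ^ 2 * inv_nat k ^ 3 - P ^ 3 * (gen_harm 2 (k - 1) * inv_nat k ^ 2)
        - P ^ 4 * (gen_harm 2 (k - 1) * inv_nat k ^ 3) - P ^ 4 * (gen_harm 2 (k - 1) * gen_harm 2 k * inv_nat k))"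
    by (rule pcong_sum) (rule sum_inverse_X_term_cong)
  ultimately have "pcong 5 (?W - (- 2 * H 1)) (H 1 - H 1 + P ^ 2 * H 3 - P ^ 3 * ((H 2 ^ 2 - H 4) / 2) - P ^ 4 * H23 - P ^ 4 * Q)"
    by (simp only: sum_subtractf sum.distrib H23_def Q_def sum_distrib_left[symmetric] H_eq_sum[symmetric])
  then obtain z where z: "z \<in> Zp" "?W - (- 2 * H 1) = H 1 - H 1 + P ^ 2 * H 3 - P ^ 3 * ((H 2 ^ 2 - H 4) / 2) - P ^ 4 * H23 - P ^ 4 * Q + P ^ 5 * z"
    by (elim pcongE)
  obtain y where y: "y \<in> Zp" "H 3 = - 3 / 2 * P * H 4 + P ^ 3 * y" using H3_cong by (elim pcongE)
  obtain x where x: "x \<in> Zp" "H 2 = 0 + P ^ 1 * x" using H2_cong_0 by (elim pcongE)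
  obtain w where w: "w \<in> Zp" "Q = 0 + P ^ 1 * w"
    using sum_gen_harm_2_product_cong_0 unfolding Q_def by (elim pcongE)
  have "?W = - 2 * H 1 + (?W - (- 2 * H 1))" by simp
  also have "\<dots> = - 2 * H 1 - P ^ 3 * H 4 - P ^ 4 * H23 + P ^ 5 * (z + y - x ^ 2 / 2 - w)"
    unfolding z(2) y(2) x(2) w(2)
    by (simp add: algebra_simps power_numeral_reduce diff_divide_distrib)
  finally show ?thesis by (rule pcongI) (use x(1) y(1) z(1) w(1) in simp)
qed

definition S0 :: rat where "S0 = (\<Sum>k=1..p - 1. 1 / (of_nat k ^ 2 * of_nat ((2 * k) choose k)))"

text \<open>Apery's identity with both of its sums inserted and \<open>H 2\<close> eliminated by
  \<open>H1_cong\<close>; the coefficient is -17/8 = -3/4 - 3/8 - 1.\<close>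

lemma S0_cong: "pcong 5 (3 * P * S0) (H 1 - 17 / 8 * P ^ 3 * H 4 - P ^ 4 * H23)"
proof -
  define Alt where "Alt = (\<Sum>k=1..p - 1. (-1) ^ (k - 1) / (of_nat k :: rat) ^ 2)"
  define W where "W = (\<Sum>k=1..p - 1. inv_nat (1 * p - k) * (1 / X (k - 1)))"
  have "(\<Sum>k=1..p - 1. 1 / ((P - of_nat k) * (\<Prod>i=1..k - 1. 1 - P ^ 2 / of_nat i ^ 2))) = W"
    unfolding W_def by (rule sum.cong) (auto simp: X_def of_nat_diff)
  then have "3 * S0 = 2 * Alt + W / P"
    using apery_like_identity_odd[OF odd_p] unfolding S0_def Alt_def by simp
  then have "P * (3 * S0) = P * (2 * Alt + W / P)" by (rule arg_cong)
  then have S0: "3 * P * S0 = 2 * (P * Alt) + W" by (simp add: distrib_left mult_ac)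
  obtain a where a: "a \<in> Zp" "Alt = - 3 / 4 * H 2 - 3 / 16 * P ^ 2 * H 4 + P ^ 4 * a"
    using alternating_sum_cong unfolding Alt_def by (elim pcongE)
  obtain w where w: "w \<in> Zp" "W = - 2 * H 1 - P ^ 3 * H 4 - P ^ 4 * H23 + P ^ 5 * w"
    using sum_inverse_X_cong unfolding W_def by (elim pcongE)
  obtain h where h: "h \<in> Zp" "P * H 2 = - 2 * H 1 + P ^ 3 * H 4 / 2 + P ^ 5 * h"
    using H1_cong by (elim pcongE)
  have "3 * P * S0 = - 3 / 2 * (P * H 2) - 3 / 8 * P ^ 3 * H 4 + 2 * P ^ 5 * a + W"
    unfolding S0 a(2) by (simp add: algebra_simps power_numeral_reduce)
  also have "\<dots> = H 1 - 17 / 8 * P ^ 3 * H 4 - P ^ 4 * H23 + P ^ 5 * (2 * a + w - 3 * h / 2)"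
    unfolding h(2) w(2) by (simp add: algebra_simps power_numeral_reduce)
  finally show ?thesis by (rule pcongI) (use a(1) w(1) h(1) in simp)
qed

section \<open>The power of p in central binomial coefficients\<close>

lemma central_choose_Suc:
  "1 / of_nat ((2 * Suc k) choose Suc k) = (1 / of_nat ((2 * k) choose k) * of_nat (Suc k) / of_nat (2 * k + 1) / 2 :: rat)"
proof -
  have "(Suc k) * ((2 * Suc k) choose Suc k) = 2 * (2 * k + 1) * ((2 * k) choose k)"
  proof -
    have "Suc k * ((2 * Suc k) choose Suc k) = Suc (2 * k + 1) * ((2 * k + 1) choose k)"
      using Suc_times_binomial_eq[of "2 * k + 1" k] by (simp add: mult.commute)
    also have "\<dots> = 2 * (Suc k * ((2 * k + 1) choose k))"
      by (simp only: mult_2 distrib_right add_Suc_right add_Suc One_nat_def add_0_right mult_Suc)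
    also have "(2 * k + 1) choose k = (2 * k + 1) choose Suc k"
      using binomial_symmetric[of k "2 * k + 1"] by simp
    also have "Suc k * ((2 * k + 1) choose Suc k) = (2 * k + 1) * ((2 * k) choose k)"
      using Suc_times_binomial_eq[of "2 * k" k] by (simp add: mult.commute)
    finally show ?thesis by (simp only: mult.assoc)
  qed
  then have eq: "of_nat (Suc k) * of_nat ((2 * Suc k) choose Suc k) = (2 * of_nat (2 * k + 1) * of_nat ((2 * k) choose k) :: rat)"
    by (metis of_nat_mult of_nat_numeral)
  have solve: "1 / a = 1 / b * s / t / 2" if "s * a = 2 * t * b" "s \<noteq> 0" "t \<noteq> 0" "b \<noteq> 0" "a \<noteq> 0" for a b s t :: rat
    using that by (simp add: field_simps)
  have "of_nat (Suc k) \<noteq> (0::rat)" "of_nat (2 * k + 1) \<noteq> (0::rat)"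
    unfolding of_nat_eq_0_iff by simp_all
  then show ?thesis by (rule solve[OF eq]) (rule central_choose_neq_0)+
qed

text \<open>For k < p the central binomial contains p at most once: in the recursion the factor p
  enters only when 2k + 1 = p. The first conjunct records integrality before that step, so that the
  induction can spend the single factor p there.\<close>

lemma Zp_P_div_central_choose:
  "k < p \<Longrightarrow> (2 * k < p \<longrightarrow> 1 / of_nat ((2 * k) choose k) \<in> Zp) \<and> P / of_nat ((2 * k) choose k) \<in> Zp"
proof (induction k)
  case 0
  show ?case by simp
next
  case (Suc k)
  let ?c = "1 / of_nat ((2 * k) choose k) :: rat"
  have IH: "2 * k < p \<Longrightarrow> ?c \<in> Zp" "P * ?c \<in> Zp" using Suc by auto
  have "1 / of_nat ((2 * Suc k) choose Suc k) \<in> Zp" if "2 * Suc k < p"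
    unfolding central_choose_Suc
    by (intro Zp_half Zp_divide_less Zp_mult IH Zp_of_nat) (use that in auto)
  moreover have "P / of_nat ((2 * Suc k) choose Suc k) = P * ?c * of_nat (Suc k) / of_nat (2 * k + 1) / 2"
    using central_choose_Suc[of k] by (metis (no_types, lifting) mult.assoc times_divide_eq_right mult_1_right)
  moreover have "P * ?c * of_nat (Suc k) / of_nat (2 * k + 1) / 2 \<in> Zp"
  proof (cases "2 * k + 1 = p")
    case True
    have cancel: "P * a * b / P / 2 = a * b / 2" for a b by simp
    have "P * ?c * of_nat (Suc k) / of_nat (2 * k + 1) / 2 = ?c * of_nat (Suc k) / 2"
      unfolding True by (rule cancel)
    also have "\<dots> \<in> Zp" by (intro Zp_half Zp_mult IH Zp_of_nat) (use True in auto)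
    finally show ?thesis .
  next
    case False
    have "\<not> p dvd 2 * k + 1"
    proof
      assume "p dvd 2 * k + 1"
      then obtain c where c: "2 * k + 1 = p * c" by (elim dvdE)
      have "p * c < p * 2" unfolding c[symmetric] using Suc.prems by simp
      then have "c < 2" by (simp only: mult_less_cancel1)
      then show False using c False by (cases c) auto
    qed
    then show ?thesis by (intro Zp_half Zp_divide_nat Zp_mult IH Zp_of_nat)
  qed
  ultimately show ?case by simp
qed

section \<open>The contribution of the sixth roots of unity\<close>

lemma not_3_dvd_p: "\<not> 3 dvd p"
proof
  assume "3 dvd p"
  then have "3 = (1 :: nat) \<or> 3 = p" using prime_p by (simp only: prime_nat_iff)
  then show False using p_gt_5 by simp
qed

text \<open>As p is prime to 6, the p-th power of a primitive sixth root of unity is again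
  primitive, hence a root of z^2 = z - 1.\<close>

lemma hex_char_step: "hex_char (n + 2 * p) = hex_char (n + p) - hex_char n"
proof -
  have "cube_char n + cube_char (n + p) + cube_char (n + 2 * p) = 0"
  proof -
    have "\<exists>s. p = 3 * s + 1 \<or> p = 3 * s + 2" using not_3_dvd_p by presburger
    then consider s where "p = 3 * s + 1" | s where "p = 3 * s + 2" by blast
    then show ?thesis
    proof cases
      case 1
      have "n + p = 3 * s + (n + 1)" "n + 2 * p = 3 * (2 * s) + (n + 2)" using 1 by simp_all
      then show ?thesis using cube_char_recurrence[of n] by (simp only: cube_char_shift)
    next
      case 2
      have "n + p = 3 * s + (n + 2)" "n + 2 * p = 3 * (2 * s + 1) + (n + 1)" using 2 by simp_all
      then show ?thesis using cube_char_recurrence[of n] by (simp only: cube_char_shift)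
    qed
  qed
  then show ?thesis using odd_p by (simp add: hex_char_def minus_one_power_iff eq_neg_iff_add_eq_0 add_ac)
qed

lemma hex_char_double_minus:
  assumes "k \<le> p"
  shows "hex_char (2 * p - k) = hex_char (p - k) - hex_char k"
proof -
  have "hex_char (2 * p - k) = hex_char (6 * p + (2 * p - k))" by (simp only: hex_char_add_6)
  also have "6 * p + (2 * p - k) = (6 * p - k) + 2 * p" using assms by simp
  also have "hex_char \<dots> = hex_char ((6 * p - k) + p) - hex_char (6 * p - k)" by (rule hex_char_step)
  also have "(6 * p - k) + p = 6 * p + (p - k)" using assms by simp
  finally show ?thesis using assms by (simp only: hex_char_add_6 hex_char_reflect)
qed

lemma Zp_cube_char [simp]: "cube_char n \<in> Zp"
  using Zp_half[of "-1"] by (simp add: cube_char_def)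

lemma Zp_hex_char [simp]: "hex_char n \<in> Zp"
  unfolding hex_char_def by (intro Zp_mult Zp_power Zp_cube_char) simp

definition coprimes :: "nat \<Rightarrow> nat set" where "coprimes N = {m \<in> {..<N * p}. \<not> p dvd m}"

lemma sum_coprimes:
  fixes f :: "nat \<Rightarrow> rat"
  shows "sum f (coprimes N) = (\<Sum>b<N. \<Sum>k=1..p - 1. f (b * p + k))"
proof -
  have "sum f (coprimes N) = (\<Sum>m<N * p. if p dvd m then 0 else f m)"
    unfolding coprimes_def by (subst sum.inter_filter) (auto intro: sum.cong)
  also have "\<dots> = (\<Sum>b<N. \<Sum>m\<in>{b * p..<b * p + p}. if p dvd m then 0 else f m)"
    by (rule sum.nat_group[symmetric])
  also have "\<dots> = (\<Sum>b<N. \<Sum>k=1..p - 1. f (b * p + k))"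
  proof (rule sum.cong)
    fix b
    have "(\<Sum>m\<in>{b * p..<b * p + p}. if p dvd m then 0 else f m)
        = (\<Sum>k\<in>{0..<p}. if p dvd k + b * p then 0 else f (k + b * p))"
      using sum.shift_bounds_nat_ivl[of "\<lambda>m. if p dvd m then 0 else f m" 0 "b * p" p] by (simp add: add.commute)
    also have "{0..<p} = insert 0 {1..p - 1}" using p_gt_5 by auto
    also have "(\<Sum>k\<in>insert 0 {1..p - 1}. if p dvd k + b * p then 0 else f (k + b * p))
        = (\<Sum>k=1..p - 1. if p dvd k + b * p then 0 else f (k + b * p))"
      by (subst sum.insert) simp_all
    also have "\<dots> = (\<Sum>k=1..p - 1. f (b * p + k))"
    proof (rule sum.cong)
      fix k assume "k \<in> {1..p - 1}"
      then have "\<not> p dvd k" by (auto dest: dvd_imp_le)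
      then show "(if p dvd k + b * p then 0 else f (k + b * p)) = f (b * p + k)"
        by (simp add: add.commute)
    qed simp
    finally show "(\<Sum>m\<in>{b * p..<b * p + p}. if p dvd m then 0 else f m) = (\<Sum>k=1..p - 1. f (b * p + k))" .
  qed simp
  finally show ?thesis .
qed

lemma sum_coprimes_multiples:
  fixes f :: "nat \<Rightarrow> rat"
  assumes "\<not> p dvd d" "d > 0"
  shows "(\<Sum>m\<in>coprimes (d * N). if d dvd m then f m else 0) = (\<Sum>m\<in>coprimes N. f (d * m))"
proof -
  have "(\<Sum>m\<in>coprimes (d * N). if d dvd m then f m else 0) = (\<Sum>m\<in>{m \<in> coprimes (d * N). d dvd m}. f m)"
    by (rule sum.inter_filter[symmetric]) (simp add: coprimes_def)
  also have "\<dots> = (\<Sum>m\<in>coprimes N. f (d * m))"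
    by (rule sum.reindex_bij_witness[of _ "\<lambda>m. d * m" "\<lambda>m. m div d"])
      (use assms prime_p in \<open>auto simp: coprimes_def prime_dvd_mult_iff elim!: dvdE\<close>)
  finally show ?thesis .
qed

lemma inv_nat_add_cong:
  assumes "k \<in> {1..p - 1}"
  shows "pcong 2 (inv_nat (b * p + k) ^ 4) (inv_nat k ^ 4 - 4 * of_nat b * P * inv_nat k ^ 5)"
proof -
  \<comment> \<open>The signs of \<open>v\<close> and \<open>x\<close> are chosen so that u = v (x -
    1), the form required by \<open>recip_expansion\<close>.\<close>
  define u v x where "u = inv_nat k" and "v = - inv_nat (b * p + k)" and "x = - (of_nat b * P * u)"
  have nd: "\<not> p dvd b * p + k" using assms by (auto simp: dvd_add_right_iff dest: dvd_imp_le)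
  have Zp: "u \<in> Zp" "v \<in> Zp"
    unfolding u_def v_def using Zp_inv_nat[OF assms] Zp_divide_nat[OF Zp_1 nd] by (auto simp del: of_nat_add)
  have "of_nat (b * p + k) \<noteq> (0::rat)" "of_nat k \<noteq> (0 :: rat)" using assms unfolding of_nat_eq_0_iff by auto
  moreover from this have "x - 1 = - (of_nat (b * p + k) / of_nat k)"
    unfolding x_def u_def by (simp add: add_divide_distrib)
  moreover have "1 / a = - (1 / d) * - (d / a)" if "d \<noteq> 0" for a d :: rat using that by simp
  ultimately have "u = v * (x - 1)" unfolding u_def v_def by metis
  from recip_expansion(4)[OF this]
  have v4: "v ^ 4 = u ^ 4 - 4 * of_nat b * P * u ^ 5 + P ^ 2 * ((of_nat b * u) ^ 2 * (10 - 20 * x + 15 * x ^ 2 - 4 * x ^ 3) * v ^ 4)"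
    unfolding x_def by (simp add: algebra_simps power_numeral_reduce)
  have v: "inv_nat (b * p + k) ^ 4 = v ^ 4" by (simp add: v_def)
  have "x \<in> Zp" unfolding x_def using Zp by simp
  then show ?thesis unfolding v u_def[symmetric] by (intro pcongI[OF v4]) (use Zp in simp)
qed

lemma sum_coprimes_char_cong:
  assumes "\<And>m. c m \<in> Zp"
  shows "pcong 2 (\<Sum>m\<in>coprimes N. c m * inv_nat m ^ 4)
    (\<Sum>b<N. \<Sum>k=1..p - 1. c (b * p + k) * (inv_nat k ^ 4 - 4 * of_nat b * P * inv_nat k ^ 5))"
  unfolding sum_coprimes by (intro pcong_sum pcong_cmult inv_nat_add_cong assms)

text \<open>The first-order terms sum to a multiple of \<open>P * H 5\<close>, which p^2
  divides.\<close>

lemma sum_coprimes_cong: "pcong 2 (\<Sum>m\<in>coprimes N. inv_nat m ^ 4) (of_nat N * H 4)"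
proof -
  have "(\<Sum>b<N. \<Sum>k=1..p - 1. 1 * (inv_nat k ^ 4 - 4 * of_nat b * P * inv_nat k ^ 5))
      = (\<Sum>b<N. H 4 - 4 * of_nat b * P * H 5)"
    by (simp only: mult_1 sum_subtractf sum_distrib_left[symmetric] H_eq_sum[symmetric])
  also have "\<dots> = of_nat N * H 4 - P * (\<Sum>b<N. 4 * of_nat b) * H 5"
    by (simp add: sum_subtractf sum_distrib_left sum_distrib_right mult_ac)
  finally have "pcong 2 (\<Sum>m\<in>coprimes N. inv_nat m ^ 4) (of_nat N * H 4 - P * (\<Sum>b<N. 4 * of_nat b) * H 5)"
    using sum_coprimes_char_cong[of "\<lambda>_. 1" N] by simp
  then obtain z where z: "z \<in> Zp" "(\<Sum>m\<in>coprimes N. inv_nat m ^ 4) = of_nat N * H 4 - P * (\<Sum>b<N. 4 * of_nat b) * H 5 + P ^ 2 * z"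
    by (elim pcongE)
  obtain w where w: "w \<in> Zp" "H 5 = 0 + P ^ 1 * w" using H5_cong_0 by (elim pcongE)
  have "(\<Sum>m\<in>coprimes N. inv_nat m ^ 4) = of_nat N * H 4 + P ^ 2 * (z - (\<Sum>b<N. 4 * of_nat b) * w)"
    unfolding z(2) w(2) by (simp add: algebra_simps power2_eq_square)
  then show ?thesis by (rule pcongI) (use z w in \<open>intro Zp_diff Zp_mult Zp_sum, auto\<close>)
qed

text \<open>First evaluation, by \<open>hex_char_eq\<close>: the multiples of d below 6p rescale to
  the numbers below 6p/d. The constant is 25/9 = 6/2 - 3/16 - 2/54 + 1/432.\<close>

lemma sum_hex_char_fourth_cong:
  "pcong 2 (\<Sum>m\<in>coprimes 6. hex_char m * inv_nat m ^ 4) (25 / 9 * H 4)"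
proof -
  define S where "S N = (\<Sum>m\<in>coprimes N. inv_nat m ^ 4)" for N
  have mult: "(\<Sum>m\<in>coprimes (d * N). if d dvd m then inv_nat m ^ 4 else 0) = S N / of_nat d ^ 4"
    if "\<not> p dvd d" "d > 0" for d N
    unfolding sum_coprimes_multiples[OF that] S_def sum_divide_distrib
    by (simp add: power_one_over power_mult_distrib mult.commute)
  have nd: "\<not> p dvd 2" "\<not> p dvd 3" "\<not> p dvd 6"
    using not_dvd_smooth[of 1 0 0] not_dvd_smooth[of 0 1 0] not_dvd_smooth[of 1 1 0] by simp_all
  have "(\<Sum>m\<in>coprimes 6. hex_char m * inv_nat m ^ 4)
     = (\<Sum>m\<in>coprimes 6. 1 / 2 * inv_nat m ^ 4 - (if 2 dvd m then inv_nat m ^ 4 else 0)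
         - 3 / 2 * (if 3 dvd m then inv_nat m ^ 4 else 0) + 3 * (if 6 dvd m then inv_nat m ^ 4 else 0))"
    by (rule sum.cong) (simp_all add: hex_char_eq algebra_simps)
  also have "\<dots> = 1 / 2 * S 6 - (\<Sum>m\<in>coprimes (2 * 3). if 2 dvd m then inv_nat m ^ 4 else 0)
      - 3 / 2 * (\<Sum>m\<in>coprimes (3 * 2). if 3 dvd m then inv_nat m ^ 4 else 0)
      + 3 * (\<Sum>m\<in>coprimes (6 * 1). if 6 dvd m then inv_nat m ^ 4 else 0)"
    by (simp add: sum.distrib sum_subtractf sum_distrib_left S_def)
  also have "\<dots> = 1 / 2 * S 6 - S 3 / of_nat 2 ^ 4 - 3 / 2 * (S 2 / of_nat 3 ^ 4) + 3 * (S 1 / of_nat 6 ^ 4)"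
    by (simp only: mult[OF nd(1) zero_less_numeral] mult[OF nd(2) zero_less_numeral] mult[OF nd(3) zero_less_numeral])
  finally have eq: "(\<Sum>m\<in>coprimes 6. hex_char m * inv_nat m ^ 4)
     = 1 / 2 * S 6 - S 3 / 16 - S 2 / 54 + S 1 / 432" by simp
  obtain a b c d where abcd: "a \<in> Zp" "b \<in> Zp" "c \<in> Zp" "d \<in> Zp"
    and s: "S 6 = of_nat 6 * H 4 + P ^ 2 * a" "S 3 = of_nat 3 * H 4 + P ^ 2 * b"
      "S 2 = of_nat 2 * H 4 + P ^ 2 * c" "S 1 = of_nat 1 * H 4 + P ^ 2 * d"
    using sum_coprimes_cong[of 6] sum_coprimes_cong[of 3] sum_coprimes_cong[of 2] sum_coprimes_cong[of 1]
    unfolding S_def[symmetric] pcong_def by metis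
  have "(\<Sum>m\<in>coprimes 6. hex_char m * inv_nat m ^ 4) = 25 / 9 * H 4 + P ^ 2 * (a / 2 - b / 16 - c / 54 + d / 432)"
    unfolding eq s by (simp add: algebra_simps add_divide_distrib)
  moreover have "c / 54 \<in> Zp" "d / 432 \<in> Zp"
    using Zp_divide_smooth[of c 1 3 0] Zp_divide_smooth[of d 4 3 0] abcd by simp_all
  then have "a / 2 - b / 16 - c / 54 + d / 432 \<in> Zp" using abcd by simp
  ultimately show ?thesis by (rule pcongI)
qed

definition hex_sum :: rat where "hex_sum = (\<Sum>k=1..p - 1. hex_char k * inv_nat k ^ 5)"

lemma reflect_fifth_cong:
  fixes f :: "nat \<Rightarrow> rat"
  assumes "\<And>k. f k \<in> Zp"
  shows "pcong 1 (\<Sum>k=1..p - 1. f k * inv_nat k ^ 5) (- (\<Sum>k=1..p - 1. f (p - k) * inv_nat k ^ 5))"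
proof -
  have "pcong 1 (inv_nat (p - k) ^ 5) (- (inv_nat k ^ 5))" if "k \<in> {1..p - 1}" for k
    using pcong_power[OF inv_nat_reflect_cong[OF that], of 5] Zp_inv_nat[OF that] by simp
  then have "pcong 1 (\<Sum>k=1..p - 1. f (p - k) * inv_nat (p - k) ^ 5) (\<Sum>k=1..p - 1. f (p - k) * - (inv_nat k ^ 5))"
    by (intro pcong_sum pcong_cmult assms)
  then show ?thesis unfolding sum_reflect[of "\<lambda>k. f k * inv_nat k ^ 5"] by (simp add: sum_negf)
qed

text \<open>Second evaluation of the same sum, by residues modulo p: it is 24 \<open>P * D\<close>,
  and two reflections give that \<open>D\<close> is 2 \<open>hex_sum\<close> modulo p. Comparison
  with \<open>sum_hex_char_fourth_cong\<close> finishes.\<close>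

lemma hex_sum_cong: "pcong 2 (48 * P * hex_sum) (25 / 9 * H 4)"
proof -
  define D where "D = (\<Sum>k=1..p - 1. hex_char (p + k) * inv_nat k ^ 5)"
  define R where "R = (\<Sum>k=1..p - 1. hex_char (p - k) * inv_nat k ^ 5)"
  have "pcong 1 hex_sum (- R)" unfolding hex_sum_def R_def by (rule reflect_fifth_cong) simp
  then obtain x where x: "x \<in> Zp" "hex_sum = - R + P ^ 1 * x" by (elim pcongE)
  have "pcong 1 D (- (\<Sum>k=1..p - 1. hex_char (p + (p - k)) * inv_nat k ^ 5))"
    unfolding D_def by (rule reflect_fifth_cong) simp
  also have "(\<Sum>k=1..p - 1. hex_char (p + (p - k)) * inv_nat k ^ 5) = R - hex_sum"
    unfolding R_def hex_sum_def sum_subtractf[symmetric]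
  proof (rule sum.cong)
    fix k assume "k \<in> {1..p - 1}"
    then have "k \<le> p" "p + (p - k) = 2 * p - k" by auto
    then have "hex_char (p + (p - k)) = hex_char (p - k) - hex_char k"
      using hex_char_double_minus[of k] by simp
    then show "hex_char (p + (p - k)) * inv_nat k ^ 5 = hex_char (p - k) * inv_nat k ^ 5 - hex_char k * inv_nat k ^ 5"
      by (simp only: left_diff_distrib)
  qed simp
  finally obtain y where y: "y \<in> Zp" "D = - (R - hex_sum) + P ^ 1 * y" by (elim pcongE)
  have "(\<Sum>b<6. \<Sum>k=1..p - 1. hex_char (b * p + k) * (inv_nat k ^ 4 - 4 * of_nat b * P * inv_nat k ^ 5))
     = (\<Sum>k=1..p - 1. \<Sum>b<6. hex_char (b * p + k) * (inv_nat k ^ 4 - 4 * of_nat b * P * inv_nat k ^ 5))"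
    by (rule sum.swap)
  also have "\<dots> = (\<Sum>k=1..p - 1. 24 * P * (hex_char (p + k) * inv_nat k ^ 5))"
  proof (rule sum.cong)
    fix k
    define a where "a b = hex_char (b * p + k)" for b
    have rec: "a (Suc (Suc b)) = a (Suc b) - a b" for b
    proof -
      have e: "Suc (Suc b) * p + k = b * p + k + 2 * p" "Suc b * p + k = b * p + k + p" by simp_all
      show ?thesis unfolding a_def e by (rule hex_char_step)
    qed
    \<comment> \<open>All six values follow from \<open>a 0\<close> and \<open>a 1\<close>. Their
      sum is 0, which kills the fourth powers, and the sum of b \<open>a b\<close> is -6
      \<open>a 1\<close>.\<close>
    have a: "a 2 = a 1 - a 0" "a 3 = - a 0" "a 4 = - a 1" "a 5 = a 0 - a 1"
      using rec[of 0] rec[of 1] rec[of 2] rec[of 3] by (simp_all add: eval_nat_numeral)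
    have "{..<6} = {0, 1, 2, 3, 4, 5::nat}" by auto
    then have "(\<Sum>b<6. a b * (u ^ 4 - 4 * of_nat b * P * u ^ 5)) = 24 * P * (a 1 * u ^ 5)" for u
      by (simp add: a algebra_simps)
    then show "(\<Sum>b<6. hex_char (b * p + k) * (inv_nat k ^ 4 - 4 * of_nat b * P * inv_nat k ^ 5)) = 24 * P * (hex_char (p + k) * inv_nat k ^ 5)"
      by (simp add: a_def)
  qed simp
  also have "\<dots> = 24 * P * D" by (simp add: D_def sum_distrib_left)
  finally have "pcong 2 (\<Sum>m\<in>coprimes 6. hex_char m * inv_nat m ^ 4) (24 * P * D)"
    using sum_coprimes_char_cong[of hex_char 6] by simp
  from pcong_trans[OF pcong_sym[OF this] sum_hex_char_fourth_cong]
  obtain z where z: "z \<in> Zp" "24 * P * D = 25 / 9 * H 4 + P ^ 2 * z" by (elim pcongE)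
  have "48 * P * hex_sum = 24 * P * D + P ^ 2 * (24 * (x - y))"
    unfolding y(2) x(2) by (simp add: algebra_simps power2_eq_square)
  also have "\<dots> = 25 / 9 * H 4 + P ^ 2 * (z + 24 * (x - y))"
    unfolding z(2) by (simp add: algebra_simps)
  finally show ?thesis by (rule pcongI) (use x(1) y(1) z(1) in simp)
qed

section \<open>Reduction of \<open>P * S4\<close> modulo p\<close>

text \<open>Consecutive ratios in n are (p - 1 - n) / (p + n), which is -(n + 1) / n modulo p. The
  factor \<open>P\<close> compensates the p in the denominator 2p - 2 choose p - 1.\<close>

lemma P_central_ratio_cong:
  assumes "n \<ge> 1" "n < p"
  shows "pcong 1 (P * central_ratio (p - 1) n) ((-1) ^ n * of_nat n)"
  using assms
proof (induction n rule: dec_induct)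
  case base
  have "central_ratio (p - 1) (Suc 0) * P = P - 1"
    using central_ratio_Suc_right[of 0 "p - 1"] p_gt_5 by (simp add: of_nat_diff)
  then show ?case by (intro pcongI[of _ _ _ 1]) (simp_all add: mult.commute)
next
  case (step n)
  define N where "N = (of_nat n :: rat)"
  define s where "s = (-1 :: rat) ^ n"
  have nd: "\<not> p dvd p + n" using step by (auto dest: dvd_imp_le)
  have ne: "P + N \<noteq> 0" using step.hyps by (simp add: N_def flip: of_nat_add)
  obtain z where z: "z \<in> Zp" "P * central_ratio (p - 1) n = s * N + P ^ 1 * z"
    using step by (auto elim: pcongE simp: s_def N_def)
  have "central_ratio (p - 1) (Suc n) * (P + N) = central_ratio (p - 1) n * (P - 1 - N)"
    using central_ratio_Suc_right[of n "p - 1"] step.prems p_gt_5 by (simp add: of_nat_diff N_def)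
  then have "P * central_ratio (p - 1) (Suc n) * (P + N) = (s * N + P * z) * (P - 1 - N)"
    using z(2) by (metis mult.assoc power_one_right)
  also have "\<dots> = - s * (N + 1) * (P + N) + P * (s * (2 * N + 1) + z * (P - 1 - N))"
    by (simp add: algebra_simps)
  finally have "P * central_ratio (p - 1) (Suc n) = - s * (N + 1) + P ^ 1 * ((s * (2 * N + 1) + z * (P - 1 - N)) / (P + N))"
    using ne by (simp add: divide_simps)
  moreover have "(s * (2 * N + 1) + z * (P - 1 - N)) / (P + N) \<in> Zp"
    using Zp_divide_nat[OF _ nd, of "s * (2 * N + 1) + z * (P - 1 - N)"] z(1) by (simp add: s_def N_def)
  moreover have "- s * (N + 1) = (-1) ^ Suc n * of_nat (Suc n)" by (simp add: s_def N_def)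
  ultimately show ?case by (metis pcongI)
qed

definition S4 :: rat where
  "S4 = (\<Sum>k=1..p - 1. elem_harm_2 (k - 1) / of_nat k ^ 2 / of_nat ((2 * k) choose k))"

text \<open>In the partial fractions of \<open>sum_elem_harm_2_central_ratio\<close> at N = p - 1, p
  divides \<open>H 2\<close> and \<open>elem_harm_2 (p - 1)\<close>, so only n^(-6) survives. Times
  (-1)^n n, and with \<open>cube_char\<close> turned into \<open>hex_char\<close>, this is
  \<open>hex_sum\<close>.\<close>

lemma S4_cong: "pcong 1 (P * S4) (2 * hex_sum)"
proof -
  define w where "w k = elem_harm_2 (k - 1) / of_nat k ^ 2" for k
  have Zpw: "w k \<in> Zp" if "k \<in> {1..p - 1}" for k
  proof -
    have "w k = elem_harm_2 (k - 1) * inv_nat k ^ 2" by (simp add: w_def power_one_over)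
    also have "\<dots> \<in> Zp" using that by (intro Zp_mult Zp_elem_harm_2 Zp_power Zp_inv_nat) auto
    finally show ?thesis .
  qed
  obtain x where x: "x \<in> Zp" "H 2 = 0 + P ^ 1 * x" using H2_cong_0 by (elim pcongE)
  obtain y where y: "y \<in> Zp" "H 4 = 0 + P ^ 1 * y" using H4_cong_0 by (elim pcongE)
  have e: "elem_harm_2 (p - 1) = P * ((P * x ^ 2 - y) / 2)"
    unfolding elem_harm_2_def x(2) y(2) by (simp add: algebra_simps power2_eq_square)
  have inner: "pcong 1 (P * (\<Sum>k=1..p - 1. w k * central_ratio k n)) ((-1) ^ n * inv_nat n ^ 5)"
    if n: "n \<in> {1..p - 1}" for n
  proof -
    define u where "u = inv_nat n"
    have u: "u \<in> Zp" unfolding u_def using n by (rule Zp_inv_nat)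
    have nn: "n \<ge> 1" "n < p" using n by auto
    have un: "of_nat n * u = 1" using n by (simp add: u_def)
    obtain z where z: "z \<in> Zp" "P * central_ratio (p - 1) n = (-1) ^ n * of_nat n + P ^ 1 * z"
      using P_central_ratio_cong[OF nn] by (elim pcongE)
    have "P * (\<Sum>k=1..p - 1. w k * central_ratio k n)
       = (P * central_ratio (p - 1) n) * (u ^ 6 - H 2 * u ^ 4 + elem_harm_2 (p - 1) * u ^ 2)"
      using sum_elem_harm_2_central_ratio[of n "p - 1"] n unfolding w_def u_def by simp
    also have "\<dots> = (-1) ^ n * (of_nat n * u) * u ^ 5 + P ^ 1 * (z * u ^ 6 + ((-1) ^ n * of_nat n + P * z) * (- x * u ^ 4 + (P * x ^ 2 - y) / 2 * u ^ 2))"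
      unfolding z(2) e x(2) by (simp add: algebra_simps power_numeral_reduce)
    finally have "P * (\<Sum>k=1..p - 1. w k * central_ratio k n) = (-1) ^ n * u ^ 5 + P ^ 1 * (z * u ^ 6 + ((-1) ^ n * of_nat n + P * z) * (- x * u ^ 4 + (P * x ^ 2 - y) / 2 * u ^ 2))"
      unfolding un by simp
    then show ?thesis unfolding u_def[symmetric] by (rule pcongI) (use x(1) y(1) z(1) u in simp)
  qed
  have S4: "P * S4 = P ^ 1 * (\<Sum>k=1..p - 1. w k) + 2 * (\<Sum>n=1..p - 1. cube_char n * (P * (\<Sum>k=1..p - 1. w k * central_ratio k n)))"
    unfolding S4_def w_def[symmetric] sum_div_central_choose by (simp add: algebra_simps sum_distrib_left)
  have 1: "pcong 1 (P ^ 1 * (\<Sum>k=1..p - 1. w k)) 0"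
    by (rule pcongI[of _ _ _ "\<Sum>k=1..p - 1. w k"]) (auto intro!: Zp_sum Zpw)
  have 2: "pcong 1 (2 * (\<Sum>n=1..p - 1. cube_char n * (P * (\<Sum>k=1..p - 1. w k * central_ratio k n))))
     (2 * (\<Sum>n=1..p - 1. cube_char n * ((-1) ^ n * inv_nat n ^ 5)))"
    by (intro pcong_cmult pcong_sum inner Zp_cube_char Zp_numeral)
  have "(\<Sum>n=1..p - 1. cube_char n * ((-1) ^ n * inv_nat n ^ 5)) = hex_sum"
    unfolding hex_sum_def hex_char_def by (simp add: mult_ac)
  with pcong_add[OF 1 2] show ?thesis unfolding S4 by (simp only: add_0)
qed

lemma P_S4_cong: "pcong 2 (P * (P * S4)) (25 / 216 * H 4)"
proof -
  obtain x where x: "x \<in> Zp" "P * S4 = 2 * hex_sum + P ^ 1 * x" using S4_cong by (elim pcongE)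
  obtain y where y: "y \<in> Zp" "48 * P * hex_sum = 25 / 9 * H 4 + P ^ 2 * y" using hex_sum_cong by (elim pcongE)
  have "P * (P * S4) = (48 * P * hex_sum) / 24 + P ^ 2 * x"
    unfolding x(2) by (simp add: algebra_simps power2_eq_square)
  also have "\<dots> = 25 / 216 * H 4 + P ^ 2 * (x + y / 8 / 3)"
    unfolding y(2) by (simp add: algebra_simps)
  finally show ?thesis by (rule pcongI) (use x(1) y(1) in \<open>intro Zp_add Zp_third Zp_divide_numerals\<close>)
qed

section \<open>Bernoulli numbers\<close>

lemma Zp_divide_fact: "x \<in> Zp \<Longrightarrow> n < p \<Longrightarrow> x / fact n \<in> Zp"
  using Zp_divide_nat[of x "fact n"] prime_p by (simp add: prime_dvd_fact_iff)

text \<open>Faulhaber's formula with N = 1 is the defining recursion of the Bernoulli numbers; below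
  p - 1 it divides only by factorials prime to p.\<close>

lemma Zp_bernoulli_div_fact: "n < p - 1 \<Longrightarrow> bernoulli n / fact n \<in> Zp"
proof (induction n rule: less_induct)
  case (less n)
  have "(\<Sum>i<n. bernoulli i / fact i * (1 / fact (n + 1 - i))) + bernoulli n / fact n = 0 ^ n / fact n"
    using sum_powers_bernoulli[where N = 1 and m = n] by (simp add: lessThan_Suc_atMost[symmetric])
  then have "bernoulli n / fact n = 0 ^ n / fact n - (\<Sum>i<n. bernoulli i / fact i * (1 / fact (n + 1 - i)))"
    by simp
  also have "\<dots> \<in> Zp"
    using less.prems by (intro Zp_diff Zp_sum Zp_mult less.IH Zp_divide_fact Zp_power) auto
  finally show ?case .
qed

lemma Zp_bernoulli: "n < p - 1 \<Longrightarrow> bernoulli n \<in> Zp"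
  using Zp_mult[OF Zp_bernoulli_div_fact Zp_of_nat[of "fact n"], of n] by simp

text \<open>In Faulhaber's formula only the term i = m carries a single factor p; all others contain
  p^2.\<close>

lemma sum_powers_cong:
  assumes "1 \<le> m" "m < p - 1"
  shows "pcong 2 (\<Sum>k=1..p - 1. of_nat k ^ m) (P * bernoulli m)"
proof -
  have "{..<p} = insert 0 {1..p - 1}" using p_gt_5 by auto
  then have "(\<Sum>k=1..p - 1. of_nat k ^ m) = (\<Sum>k<p. of_nat k ^ m :: rat)"
    using assms by simp
  also have "\<dots> = fact m * ((\<Sum>k<p. of_nat k ^ m) / fact m)" by simp
  also have "\<dots> = fact m * (\<Sum>i\<le>m. bernoulli i / fact i * (P ^ (m + 1 - i) / fact (m + 1 - i)))"
    unfolding sum_powers_bernoulli ..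
  also have "(\<Sum>i\<le>m. bernoulli i / fact i * (P ^ (m + 1 - i) / fact (m + 1 - i)))
      = (\<Sum>i<m. bernoulli i / fact i * (P ^ (m + 1 - i) / fact (m + 1 - i))) + bernoulli m / fact m * P"
    by (simp add: lessThan_Suc_atMost[symmetric])
  also have "(\<Sum>i<m. bernoulli i / fact i * (P ^ (m + 1 - i) / fact (m + 1 - i)))
      = P ^ 2 * (\<Sum>i<m. bernoulli i / fact i * (P ^ (m - 1 - i) / fact (m + 1 - i)))"
    unfolding sum_distrib_left
  proof (rule sum.cong)
    fix i assume "i \<in> {..<m}"
    then have "m + 1 - i = 2 + (m - 1 - i)" by auto
    then have "P ^ (m + 1 - i) = P ^ 2 * P ^ (m - 1 - i)" by (simp only: power_add)
    then show "bernoulli i / fact i * (P ^ (m + 1 - i) / fact (m + 1 - i))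
      = P ^ 2 * (bernoulli i / fact i * (P ^ (m - 1 - i) / fact (m + 1 - i)))" by simp
  qed simp
  finally have "(\<Sum>k=1..p - 1. of_nat k ^ m) = P * bernoulli m
      + P ^ 2 * (of_nat (fact m) * (\<Sum>i<m. bernoulli i / fact i * (P ^ (m - 1 - i) / fact (m + 1 - i))))"
    by (simp add: algebra_simps)
  moreover have "of_nat (fact m) * (\<Sum>i<m. bernoulli i / fact i * (P ^ (m - 1 - i) / fact (m + 1 - i))) \<in> Zp"
    using assms by (intro Zp_mult Zp_sum Zp_of_nat Zp_bernoulli_div_fact Zp_divide_fact Zp_power) auto
  ultimately show ?thesis by (rule pcongI)
qed

lemma sum_powers_cong_0:
  assumes "1 \<le> m" "m < p - 1"
  shows "pcong 1 (\<Sum>k=1..p - 1. of_nat k ^ m) 0"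
proof -
  obtain z where z: "z \<in> Zp" "(\<Sum>k=1..p - 1. of_nat k ^ m) = P * bernoulli m + P ^ 2 * z"
    using sum_powers_cong[OF assms] by (elim pcongE)
  have "(\<Sum>k=1..p - 1. of_nat k ^ m) = 0 + P ^ 1 * (bernoulli m + P * z)"
    unfolding z(2) by (simp add: algebra_simps power2_eq_square)
  then show ?thesis by (rule pcongI) (use z Zp_bernoulli[OF assms(2)] in simp)
qed

lemma fermat_cong:
  assumes "\<not> p dvd k"
  shows "pcong 1 (of_nat k ^ (p - 1)) 1"
proof -
  have "[k ^ (p - 1) = 1] (mod p)" using prime_p assms by (rule fermat_theorem)
  then have "[int (k ^ (p - 1)) = int 1] (mod int p)" by (simp only: cong_int_iff)
  then have "int p dvd int (k ^ (p - 1)) - 1" by (simp add: cong_iff_dvd_diff)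
  then obtain c where "int (k ^ (p - 1)) - 1 = int p * c" by (elim dvdE)
  then have "int (k ^ (p - 1)) = 1 + int p * c" by simp
  then have "of_int (int (k ^ (p - 1))) = (of_int (1 + int p * c) :: rat)" by (rule arg_cong)
  then have "of_nat k ^ (p - 1) = 1 + P ^ 1 * of_int c" by simp
  then show ?thesis by (rule pcongI) simp
qed

lemma inv_nat_power_cong:
  assumes "k \<in> {1..p - 1}" "s \<le> p - 1"
  shows "pcong 1 (of_nat k ^ (p - 1 - s)) (inv_nat k ^ s)"
proof -
  have nd: "\<not> p dvd k" using assms by (auto dest: dvd_imp_le)
  have "of_nat k ^ (p - 1) = (of_nat k ^ (p - 1 - s) * of_nat k ^ s :: rat)"
    unfolding power_add[symmetric] using assms(2) by (intro arg_cong2[where f = "(^)"]) linarith+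
  then have e: "of_nat k ^ (p - 1 - s) = inv_nat k ^ s * of_nat k ^ (p - 1)"
    using assms(1) by (simp add: power_one_over)
  have "pcong 1 (inv_nat k ^ s * of_nat k ^ (p - 1)) (inv_nat k ^ s * 1)"
    using assms(1) by (intro pcong_cmult fermat_cong nd Zp_power Zp_inv_nat)
  then show ?thesis unfolding e by simp
qed

lemma power_add_cong:
  assumes "y \<in> Zp" "d \<in> Zp"
  shows "pcong 2 ((y + P * d) ^ Suc n) (y ^ Suc n + of_nat (Suc n) * P * d * y ^ n)"
proof (induction n)
  case 0
  show ?case by simp
next
  case (Suc n)
  define m where "m = (of_nat (Suc n) :: rat)"
  obtain z where z: "z \<in> Zp" "(y + P * d) ^ Suc n = y ^ Suc n + m * P * d * y ^ n + P ^ 2 * z"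
    using Suc unfolding m_def by (elim pcongE)
  have "(y + P * d) ^ Suc (Suc n) = (y + P * d) * (y ^ Suc n + m * P * d * y ^ n + P ^ 2 * z)"
    unfolding power_Suc[of _ "Suc n"] z(2) ..
  also have "\<dots> = y ^ Suc (Suc n) + (m + 1) * P * d * y ^ Suc n + P ^ 2 * (y * z + m * d ^ 2 * y ^ n + P * d * z)"
    by (simp add: algebra_simps power2_eq_square)
  also have "m + 1 = of_nat (Suc (Suc n))" by (simp add: m_def)
  finally show ?case by (rule pcongI) (use z(1) assms in \<open>simp add: m_def\<close>)
qed

lemma sum_evens_powers_cong:
  assumes "even n" "n > 0" "c > 0"
  shows "pcong 2 (\<Sum>k\<in>evens. of_nat k ^ n + of_nat (c * p - k) ^ n)
    (2 * (\<Sum>k\<in>evens. of_nat k ^ n) - of_nat c * of_nat n * P * (\<Sum>k\<in>evens. of_nat k ^ (n - 1)))"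
proof -
  obtain m where m: "n = Suc m" "odd m" using assms(1,2) by (cases n) auto
  have "pcong 2 (of_nat k ^ n + of_nat (c * p - k) ^ n)
      (2 * of_nat k ^ n - of_nat c * of_nat n * P * of_nat k ^ (n - 1))" if k: "k \<in> evens" for k
  proof -
    have "k \<le> p" "p \<le> c * p" using k assms(3) by auto
    then have "k \<le> c * p" by (rule le_trans)
    then have e: "of_nat (c * p - k) = (- of_nat k + P * of_nat c :: rat)" by (simp add: of_nat_diff)
    have "pcong 2 (of_nat (c * p - k) ^ n) ((- of_nat k) ^ Suc m + of_nat (Suc m) * P * of_nat c * (- of_nat k) ^ m)"
      unfolding e m(1) by (rule power_add_cong) simp_all
    from pcong_add[OF pcong_refl[of 2 "of_nat k ^ n"] this]
    show ?thesis using m by (simp add: algebra_simps)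
  qed
  then have "pcong 2 (\<Sum>k\<in>evens. of_nat k ^ n + of_nat (c * p - k) ^ n)
      (\<Sum>k\<in>evens. 2 * of_nat k ^ n - of_nat c * of_nat n * P * of_nat k ^ (n - 1))"
    by (rule pcong_sum)
  then show ?thesis by (simp only: sum_subtractf sum_distrib_left[symmetric])
qed

text \<open>Fermat relates k^(p-5) and 1/k^4 only modulo p, so a detour gains one power: splitting
  by parity ties both \<open>H 4\<close> and the power sum \<open>G\<close> to p times a sum over
  \<open>evens\<close>, namely \<open>E 5\<close> and \<open>F\<close>. These need to agree only
  modulo p.\<close>

lemma H4_bernoulli_cong: "pcong 2 (H 4) (4 / 5 * P * bernoulli (p - 5))"
proof -
  define n G where "n = p - 5" and "G = (\<Sum>k=1..p - 1. of_nat k ^ n :: rat)"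
  define F Q where "F = (\<Sum>k\<in>evens. of_nat k ^ (n - 1) :: rat)" and "Q = (\<Sum>k\<in>evens. of_nat k ^ n :: rat)"
  have n: "even n" "n > 0" "1 \<le> n" "n < p - 1" using odd_p p_gt_5 by (auto simp: n_def)
  have Pn: "of_nat n = P - 5" using p_gt_5 by (simp add: n_def of_nat_diff)
  have "G = (\<Sum>k\<in>evens. of_nat k ^ n + of_nat (1 * p - k) ^ n)"
    unfolding G_def by (subst sum_split_evens) simp
  then have "pcong 2 G (2 * Q - of_nat 1 * of_nat n * P * F)"
    using sum_evens_powers_cong[OF n(1,2), of 1] unfolding Q_def F_def by simp
  then obtain x where x: "x \<in> Zp" "G = 2 * Q - of_nat 1 * of_nat n * P * F + P ^ 2 * x" by (elim pcongE)
  have "2 ^ n * G = (\<Sum>k=1..p - 1. of_nat (2 * k) ^ n)"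
    unfolding G_def sum_distrib_left by (simp add: power_mult_distrib)
  also have "\<dots> = (\<Sum>k\<in>evens. of_nat k ^ n + of_nat (2 * p - k) ^ n)"
    by (rule sum_double_split_evens)
  finally have "pcong 2 (2 ^ n * G) (2 * Q - of_nat 2 * of_nat n * P * F)"
    using sum_evens_powers_cong[OF n(1,2), of 2] unfolding Q_def F_def by simp
  then obtain y where y: "y \<in> Zp" "2 ^ n * G = 2 * Q - of_nat 2 * of_nat n * P * F + P ^ 2 * y" by (elim pcongE)
  obtain g where g: "g \<in> Zp" "G = 0 + P ^ 1 * g" using sum_powers_cong_0[OF n(3,4)] unfolding G_def by (elim pcongE)
  have "pcong 1 F (E 5)"
    unfolding F_def E_def
  proof (rule pcong_sum)
    fix k assume "k \<in> evens"
    then have "pcong 1 (of_nat k ^ (p - 1 - 5)) (inv_nat k ^ 5)" using p_gt_5 by (intro inv_nat_power_cong) auto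
    then show "pcong 1 (of_nat k ^ (n - 1)) (inv_nat k ^ 5)" by (simp add: n_def)
  qed
  then obtain f where f: "f \<in> Zp" "F = E 5 + P ^ 1 * f" by (elim pcongE)
  obtain e where e: "e \<in> Zp" "P * E 5 = - 15 / 64 * H 4 + P ^ 2 * e" using E5_cong by (elim pcongE)
  have "\<not> p dvd 2" using not_dvd_smooth[of 1 0 0] by simp
  then obtain t where t: "t \<in> Zp" "2 ^ (p - 1) = 1 + P ^ 1 * t"
    using fermat_cong[of 2] by (auto elim: pcongE)
  have "p - 1 = n + 4" using p_gt_5 by (simp add: n_def)
  then have "2 ^ (p - 1) = 2 ^ n * (16 :: rat)" by (simp add: power_add)
  \<comment> \<open>Hence (2^n - 1) \<open>G\<close> is -15/16 \<open>G\<close> modulo p^2, since p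
    already divides \<open>G\<close>.\<close>
  then have t2: "2 ^ n = (1 + P * t) / 16" using t(2) by simp
  obtain b where b: "b \<in> Zp" "G = P * bernoulli n + P ^ 2 * b"
    using sum_powers_cong[OF n(3,4)] unfolding G_def by (elim pcongE)
  have "2 ^ n * G - G = (5 - P) * (P * F) + P ^ 2 * (y - x)"
    unfolding y(2) unfolding x(2) by (simp add: Pn algebra_simps)
  also have "P * F = - 15 / 64 * H 4 + P ^ 2 * (e + f)"
    unfolding f(2) by (simp add: distrib_left e(2) power2_eq_square algebra_simps)
  finally have 1: "2 ^ n * G - G = (5 - P) * (- 15 / 64 * H 4 + P ^ 2 * (e + f)) + P ^ 2 * (y - x)" .
  obtain h where h: "h \<in> Zp" "H 4 = 0 + P ^ 1 * h" using H4_cong_0 by (elim pcongE)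
  have "2 ^ n * G - G = - 15 / 16 * G + P * t / 16 * G" unfolding t2 by (simp add: algebra_simps)
  also have "P * t / 16 * G = P ^ 2 * (t * g / 16)" unfolding g(2) by (simp add: power2_eq_square)
  finally have 2: "- 15 / 16 * G + P ^ 2 * (t * g / 16) = (5 - P) * (- 15 / 64 * H 4 + P ^ 2 * (e + f)) + P ^ 2 * (y - x)"
    using 1 by simp
  have "15 / 16 * G = P ^ 2 * (t * g / 16) - (- 15 / 16 * G + P ^ 2 * (t * g / 16))" by simp
  also have "\<dots> = 75 / 64 * H 4 + P ^ 2 * (t * g / 16 - (5 - P) * (e + f) - (y - x)) - P * (15 / 64 * H 4)"
    unfolding 2 by (simp add: algebra_simps diff_divide_distrib add_divide_distrib)
  finally have 2: "15 / 16 * G = 75 / 64 * H 4 + P ^ 2 * (t * g / 16 - (5 - P) * (e + f) - (y - x)) - P * (15 / 64 * H 4)" .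
  have "P * (15 / 64 * H 4) = P ^ 2 * (15 * h / 64)" unfolding h(2) by (simp add: power2_eq_square)
  with 2 have "H 4 = 4 / 5 * G - 64 / 75 * (P ^ 2 * (t * g / 16 - (5 - P) * (e + f) - (y - x) - 15 * h / 64))"
    by (simp add: algebra_simps)
  also have "\<dots> = 4 / 5 * P * bernoulli n + P ^ 2 * (4 * b / 5 - 64 * (t * g / 16 - (5 - P) * (e + f) - (y - x) - 15 * h / 64) / 15 / 5)"
    unfolding b(2) by (simp add: algebra_simps diff_divide_distrib add_divide_distrib)
  finally show ?thesis unfolding n_def[symmetric]
    by (rule pcongI) (use x(1) y(1) g(1) f(1) e(1) t(1) b(1) h(1) in
      \<open>intro Zp_diff Zp_fifth Zp_half Zp_divide_numerals Zp_mult Zp_add Zp_numeral Zp_of_nat\<close>)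
qed

section \<open>The double sum \<open>H23\<close> and the final assembly\<close>

text \<open>The exponents e - 3 range over -2, ..., p - 5, where 0 is the only multiple of p - 1;
  there the sum is p - 1.\<close>

lemma sum_power_times_inverse_cube_cong:
  assumes "1 \<le> e" "e \<le> p - 2"
  shows "pcong 1 (\<Sum>k=1..p - 1. of_nat k ^ e * inv_nat k ^ 3) (if e = 3 then - 1 else 0)"
proof -
  consider "e = 1" | "e = 2" | "e = 3" | "e > 3" using assms by linarith
  then show ?thesis
  proof cases
    case 1
    have "(\<Sum>k=1..p - 1. of_nat k ^ e * inv_nat k ^ 3) = H 2"
      unfolding H_eq_sum 1 by (rule sum.cong) (auto simp: power_numeral_reduce)
    then show ?thesis using H2_cong_0 1 by simp
  next
    case 2
    have "(\<Sum>k=1..p - 1. of_nat k ^ e * inv_nat k ^ 3) = H 1"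
      unfolding H_eq_sum 2 by (rule sum.cong) (auto simp: power_numeral_reduce)
    moreover have "pcong 1 (H 1) 0"
    proof -
      obtain z where z: "z \<in> Zp" "P * H 2 = - 2 * H 1 + P ^ 3 * H 4 / 2 + P ^ 5 * z" using H1_cong by (elim pcongE)
      have "H 1 = 0 + P ^ 1 * (P ^ 2 * H 4 / 4 + P ^ 4 * z / 2 - H 2 / 2)"
        using z(2) by (simp add: algebra_simps power_numeral_reduce)
      then show ?thesis by (rule pcongI) (use z(1) Zp_H[of 2] Zp_H[of 4] in simp)
    qed
    ultimately show ?thesis using 2 by simp
  next
    case 3
    have "(\<Sum>k=1..p - 1. of_nat k ^ e * inv_nat k ^ 3) = (\<Sum>k=1..p - 1. 1)"
      unfolding 3 by (rule sum.cong) (auto simp: power_one_over)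
    also have "\<dots> = - 1 + P ^ 1 * 1" using p_gt_5 by (simp add: of_nat_diff)
    finally show ?thesis using 3 by (auto intro: pcongI[OF _ Zp_1])
  next
    case 4
    have "(\<Sum>k=1..p - 1. of_nat k ^ e * inv_nat k ^ 3) = (\<Sum>k=1..p - 1. of_nat k ^ (e - 3))"
      using 4 by (intro sum.cong) (auto simp: power_diff power_one_over)
    then show ?thesis using sum_powers_cong_0[of "e - 3"] 4 assms by simp
  qed
qed

text \<open>Modulo p, replace 1/j^2 by j^(p-3) and write the inner sum as Faulhaber's polynomial in
  k. After multiplication by 1/k^3 only its k^3 coefficient, at i = p - 5, contributes; it is
  (p-3)(p-4)/6 \<open>bernoulli (p - 5)\<close>, that is 2 \<open>bernoulli (p - 5)\<close> modulo
  p.\<close>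

lemma H23_cong: "pcong 1 H23 (- 2 * bernoulli (p - 5))"
proof -
  define m where "m = p - 3"
  have m: "m > 0" "m < p - 1" "m = p - 1 - 2" using p_gt_5 by (auto simp: m_def)
  define a where "a i = fact m * (bernoulli i / fact i) / fact (m + 1 - i)" for i
  have Zpa: "a i \<in> Zp" if "i \<le> m" for i
  proof -
    have "a i = of_nat (fact m) * (bernoulli i / fact i) / fact (m + 1 - i)" by (simp add: a_def)
    also have "\<dots> \<in> Zp" using that m by (intro Zp_divide_fact Zp_mult Zp_of_nat Zp_bernoulli_div_fact) auto
    finally show ?thesis .
  qed
  have inner: "pcong 1 (gen_harm 2 (k - 1)) (\<Sum>i\<le>m. a i * of_nat k ^ (m + 1 - i))" if k: "k \<in> {1..p - 1}" for k
  proof -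
    have "pcong 1 (\<Sum>j=1..k - 1. of_nat j ^ m) (\<Sum>j=1..k - 1. inv_nat j ^ 2)"
      unfolding m(3) using k p_gt_5 by (intro pcong_sum inv_nat_power_cong) auto
    moreover have "(\<Sum>j=1..k - 1. inv_nat j ^ 2) = gen_harm 2 (k - 1)"
      by (simp add: gen_harm_def power_one_over)
    moreover have "(\<Sum>j=1..k - 1. of_nat j ^ m) = (\<Sum>i\<le>m. a i * (of_nat k :: rat) ^ (m + 1 - i))"
    proof -
      have "{..<k} = insert 0 {1..k - 1}" using k by auto
      then have "(\<Sum>j=1..k - 1. of_nat j ^ m) = fact m * ((\<Sum>j<k. of_nat j ^ m :: rat) / fact m)" using m(1) by simp
      also have "\<dots> = (\<Sum>i\<le>m. a i * of_nat k ^ (m + 1 - i))"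
        unfolding sum_powers_bernoulli sum_distrib_left a_def by (intro sum.cong) auto
      finally show ?thesis .
    qed
    ultimately show ?thesis by (simp add: pcong_sym)
  qed
  have "pcong 1 (gen_harm 2 (k - 1) * inv_nat k ^ 3) ((\<Sum>i\<le>m. a i * of_nat k ^ (m + 1 - i)) * inv_nat k ^ 3)"
    if k: "k \<in> {1..p - 1}" for k
    using pcong_cmult[OF inner[OF k], of "inv_nat k ^ 3"] Zp_inv_nat[OF k] by (simp add: mult.commute)
  then have "pcong 1 H23 (\<Sum>k=1..p - 1. (\<Sum>i\<le>m. a i * of_nat k ^ (m + 1 - i)) * inv_nat k ^ 3)"
    unfolding H23_def by (rule pcong_sum)
  also have "(\<Sum>k=1..p - 1. (\<Sum>i\<le>m. a i * of_nat k ^ (m + 1 - i)) * inv_nat k ^ 3)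
     = (\<Sum>i\<le>m. a i * (\<Sum>k=1..p - 1. of_nat k ^ (m + 1 - i) * inv_nat k ^ 3))"
    unfolding sum_distrib_left sum_distrib_right mult.assoc by (rule sum.swap)
  also have "pcong 1 \<dots> (\<Sum>i\<le>m. a i * (if m + 1 - i = 3 then - 1 else 0))"
    using m by (intro pcong_sum pcong_cmult sum_power_times_inverse_cube_cong Zpa) auto
  also have "(\<Sum>i\<le>m. a i * (if m + 1 - i = 3 then - 1 else 0)) = (\<Sum>i\<le>m. if i = p - 5 then - a i else 0)"
    using p_gt_5 by (intro sum.cong) (auto simp: m_def)
  also have "\<dots> = - a (p - 5)" using p_gt_5 by (simp add: m_def)
  also have "a (p - 5) = (P - 3) * (P - 4) * bernoulli (p - 5) / 6"
  proof -
    obtain s where s: "p = s + 5" using p_gt_5 le_Suc_ex[of 5 p] by (metis add.commute less_imp_le)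
    have "m = Suc (Suc s)" "m + 1 - (p - 5) = 3" "p - 5 = s" by (simp_all add: m_def s)
    then show ?thesis unfolding a_def by (simp add: s fact_numeral)
  qed
  also have "- ((P - 3) * (P - 4) * bernoulli (p - 5) / 6)
      = - 2 * bernoulli (p - 5) + P ^ 1 * ((7 - P) * bernoulli (p - 5) / 6)"
    by (simp add: algebra_simps diff_divide_distrib add_divide_distrib)
  finally obtain z where z: "z \<in> Zp"
    "H23 = - 2 * bernoulli (p - 5) + P ^ 1 * ((7 - P) * bernoulli (p - 5) / 6) + P ^ 1 * z" by (elim pcongE)
  then have "H23 = - 2 * bernoulli (p - 5) + P ^ 1 * ((7 - P) * bernoulli (p - 5) / 6 + z)"
    by (simp add: algebra_simps)
  then show ?thesis by (rule pcongI) (use z(1) Zp_bernoulli[of "p - 5"] p_gt_5 in simp)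
qed

text \<open>The extra factor \<open>P\<close> in the weights \<open>w\<close> makes them p-integral,
  so \<open>X\<close> may be expanded modulo p^6 inside the vanishing sum. Solving for
  \<open>P ^ 3 * S2\<close> modulo p^5 and cancelling p^3 leaves p^2.\<close>

lemma sum_harm_div_central_choose_cong:
  "pcong 2 (\<Sum>k=1..p - 1. gen_harm 2 (k - 1) / (of_nat k ^ 2 * of_nat ((2 * k) choose k)))
    (gen_harm 1 (p - 1) / (3 * P ^ 3) + 26 / 135 * P * bernoulli (p - 5))"
proof -
  define S2 where "S2 = (\<Sum>k=1..p - 1. gen_harm 2 (k - 1) / (of_nat k ^ 2 * of_nat ((2 * k) choose k)))"
  define w where "w k = P * (1 / (of_nat k ^ 2 * of_nat ((2 * k) choose k)))" for k :: nat
  define B where "B = bernoulli (p - 5)"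
  have Zpw: "w k \<in> Zp" if k: "k \<in> {1..p - 1}" for k
  proof -
    have "w k = inv_nat k ^ 2 * (P / of_nat ((2 * k) choose k))" by (simp add: w_def power_one_over)
    also have "\<dots> \<in> Zp" using k Zp_P_div_central_choose[of k] by (intro Zp_mult Zp_power Zp_inv_nat) auto
    finally show ?thesis .
  qed
  have "pcong 6 (\<Sum>k=1..p - 1. w k * X (k - 1))
      (\<Sum>k=1..p - 1. w k * (1 - P ^ 2 * gen_harm 2 (k - 1) + P ^ 4 * elem_harm_2 (k - 1)))"
    by (intro pcong_sum pcong_cmult X_cong Zpw) auto
  also have "(\<Sum>k=1..p - 1. w k * (1 - P ^ 2 * gen_harm 2 (k - 1) + P ^ 4 * elem_harm_2 (k - 1)))
     = P * S0 - P ^ 3 * S2 + P ^ 4 * (P * S4)"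
    unfolding S0_def S2_def S4_def sum_distrib_left sum_subtractf[symmetric] sum.distrib[symmetric]
    by (rule sum.cong) (simp_all add: w_def algebra_simps power_numeral_reduce)
  also have "(\<Sum>k=1..p - 1. w k * X (k - 1)) = 0"
  proof -
    have "(\<Sum>k=1..p - 1. w k * X (k - 1))
        = P * (\<Sum>k=1..p - 1. X (k - 1) / of_nat k ^ 2 / of_nat ((2 * k) choose k))"
      unfolding sum_distrib_left by (simp add: w_def)
    then show ?thesis
      using sum_prod_div_central_choose_eq_0[OF odd_p not_3_dvd_p] unfolding X_def by simp
  qed
  finally obtain x where x: "x \<in> Zp" "0 = P * S0 - P ^ 3 * S2 + P ^ 4 * (P * S4) + P ^ 6 * x" by (elim pcongE)
  obtain a where a: "a \<in> Zp" "3 * P * S0 = H 1 - 17 / 8 * P ^ 3 * H 4 - P ^ 4 * H23 + P ^ 5 * a"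
    using S0_cong by (elim pcongE)
  obtain b where b: "b \<in> Zp" "P * (P * S4) = 25 / 216 * H 4 + P ^ 2 * b" using P_S4_cong by (elim pcongE)
  obtain c where c: "c \<in> Zp" "H 4 = 4 / 5 * P * B + P ^ 2 * c" using H4_bernoulli_cong unfolding B_def by (elim pcongE)
  obtain d where d: "d \<in> Zp" "H23 = - 2 * B + P ^ 1 * d" using H23_cong unfolding B_def by (elim pcongE)
  have "P ^ 3 * S2 = (3 * P * S0) / 3 + P ^ 3 * (P * (P * S4)) + P ^ 6 * x"
    using x(2) by (simp add: algebra_simps power_numeral_reduce)
  \<comment> \<open>The coefficient of \<open>P ^ 3 * H 4\<close> is -17/24 + 25/216 = -16/27. With
    \<open>H 4\<close> and \<open>H23\<close> inserted next, that of \<open>P ^ 4 * B\<close> is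
    -64/135 + 2/3 = 26/135.\<close>
  also have "\<dots> = H 1 / 3 - 16 / 27 * P ^ 3 * H 4 - P ^ 4 * H23 / 3 + P ^ 5 * (a / 3 + b + P * x)"
    unfolding a(2) b(2) by (simp add: algebra_simps power_numeral_reduce diff_divide_distrib add_divide_distrib)
  also have "\<dots> = H 1 / 3 + 26 / 135 * P ^ 4 * B + P ^ 5 * (a / 3 + b + P * x - 16 * c / 3 / 9 - d / 3)"
    unfolding c(2) d(2) by (simp add: algebra_simps power_numeral_reduce diff_divide_distrib add_divide_distrib)
  also have "\<dots> = P ^ 3 * (H 1 / (3 * P ^ 3) + 26 / 135 * P * B + P ^ 2 * (a / 3 + b + P * x - 16 * c / 3 / 9 - d / 3))"
    by (simp add: distrib_left power_numeral_reduce)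
  finally have "S2 = H 1 / (3 * P ^ 3) + 26 / 135 * P * B + P ^ 2 * (a / 3 + b + P * x - 16 * c / 3 / 9 - d / 3)"
    by simp
  then show ?thesis unfolding S2_def[symmetric] B_def[symmetric]
    by (rule pcongI) (use a(1) b(1) c(1) d(1) x(1) in
      \<open>intro Zp_diff Zp_third Zp_divide_numerals Zp_mult Zp_add Zp_numeral Zp_of_nat\<close>)
qed

end

theorem mainTheorem2:
  fixes p :: nat
  assumes "prime p" and "p > 5"
  shows "rat_cong p 2
           (\<Sum>k=1..p-1. gen_harm 2 (k - 1) / (of_nat k ^ 2 * of_nat ((2 * k) choose k)))
           (gen_harm 1 (p - 1) / (3 * of_nat p ^ 3)
              + 26 / 135 * of_nat p * bernoulli (p - 5))"
proof -
  interpret prime_gt_5 p using assms by unfold_locales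
  show ?thesis by (rule rat_cong_of_pcong[OF sum_harm_div_central_choose_cong])
qed

end
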